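(* For every $a\in(0,1)$ there exists $\epsilon>0$ such that for all $\widetilde a\in(0,1)$ with $|\widetilde a-a|<\epsilon$, one has $\operatorname{Re}(n_a^*n_{\widetilde a}+d_a^*d_{\widetilde a})>0$ on $i\mathbb{R}$, hence $\iota(n_a^*n_{\widetilde a}+d_a^*d_{\widetilde a})=0$, and the $\nu$-metric distance $d(p_a,p_{\widetilde a})$ between the transfer functions $p_a$ and $p_{\widetilde a}$, where $p_a(s)=\dfrac{\cosh(a\sqrt s)}{\sqrt s\,\sinh\sqrt s}$ for $s\in\mathbb{C}_+$, is the chordal distance, given by $$d(p_a,p_{\widetilde a})=\sup_{y\in\mathbb{R}}\frac{|n_a(iy)d_{\widetilde a}(iy)-d_a(iy)n_{\widetilde a}(iy)|}{\sqrt{|n_a(iy)|^2+|d_a(iy)|^2}\,\sqrt{|n_{\widetilde a}(iy)|^2+|d_{\widetilde a}(iy)|^2}}$$ $$=\sup_{y>0}\frac{\sqrt y\,|\cosh(a\sqrt y\,\zeta)-\cosh(\widetilde a\sqrt y\,\zeta)|}{\sqrt{|\cosh(a\sqrt y\,\zeta)|^2+y|\sinh(\sqrt y\,\zeta)\sinh(a\sqrt y\,\zeta)|^2}\,\sqrt{|\cosh(\widetilde a\sqrt y\,\zeta)|^2+y|\sinh(\sqrt y\,\zeta)\sinh(\widetilde a\sqrt y\,\zeta)|^2}},$$ where $\zeta=e^{i\pi/4}$.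
   Context: Notation. $\mathbb{C}_+=\{s\in\mathbb{C}:\operatorname{Re}s>0\}$, and $\sqrt s=e^{\frac12\operatorname{Log}s}$ with $\operatorname{Log}$ the principal logarithm (argument in $(-\pi,\pi]$). $H^\infty$ is the Banach algebra of bounded holomorphic functions on $\mathbb{C}_+$ with the supremum norm. For $a\in(0,1)$ and $s\in\mathbb{C}_+$, $$n_a(s)=\frac{1}{\sqrt s+1}\cdot\frac{\sinh(a\sqrt s)}{\sinh\sqrt s},\qquad d_a(s)=\frac{\sqrt s}{\sqrt s+1}\cdot\frac{\sinh(a\sqrt s)}{\cosh(a\sqrt s)}.$$ These belong to $H^\infty$, are coprime in $H^\infty$, and $p_a=n_a/d_a$. On $i\mathbb{R}$, $n_a$ and $d_a$ denote the boundary values, given for $y\neq 0$ by the same formulas with $s=iy$ and at $y=0$ by continuity; on $i\mathbb{R}$ the symbol $^*$ denotes pointwise complex conjugation. Passage to the disc. Let $\mathbb{D}=\{z\in\mathbb{C}:|z|<1\}$ and let $H^\infty(\mathbb{D})$ be the algebra of bounded holomorphic functions on $\mathbb{D}$. Functions on $\mathbb{C}_+$ are identified with functions on $\mathbb{D}$ via $s=\frac{1+z}{1-z}$, $z=\frac{s-1}{s+1}$; under this identification $H^\infty$ corresponds to $H^\infty(\mathbb{D})$, and the $\nu$-metric on plants over $H^\infty$ (and the index $\iota$) is the one defined below for the corresponding objects over $H^\infty(\mathbb{D})$. The limit algebra. For $r\in(0,1)$ let $\mathbb{A}_r=\{z:r<|z|<1\}$ and let $C_b(\mathbb{A}_r)$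 be the $C^*$-algebra of bounded continuous functions $\mathbb{A}_r\to\mathbb{C}$ (supremum norm, involution = pointwise complex conjugation). Let $\mathscr{A}$ be the $*$-algebra of families $f=(f_r)_{r\in(0,1)}\in\prod_{r\in(0,1)} C_b(\mathbb{A}_r)$ for which there is $r_0\in(0,1)$ such that $f_r|_{\mathbb{A}_R}=f_R$ whenever $r_0\le r\le R<1$, with seminorm $\|f\|=\lim_{r\to1}\|f_r\|_\infty$. Let $\mathscr{N}$ be its kernel; $\varinjlim C_b(\mathbb{A}_r):=\mathscr{A}/\mathscr{N}$ is a unital commutative $C^*$-algebra. $H^\infty(\mathbb{D})$ is embedded in it by sending $f$ to the class of $(f|_{\mathbb{A}_r})_{r}$; elements of $H^\infty(\mathbb{D})$ are regarded as elements of $\varinjlim C_b(\mathbb{A}_r)$ in this way. For a $C^*$-algebra $S$, $\operatorname{inv}S$ denotes its set of invertible elements. The index. If $f\in\operatorname{inv}C_b(\mathbb{A}_\rho)$, let $w(f)\in\mathbb{Z}$ be the winding number about $0$ of $\xi\mapsto f(r\xi)$, $|\xi|=1$, for any $r\in(\rho,1)$ (independent of $r$). For $f=[(f_r)]\in\operatorname{inv}(\varinjlim C_b(\mathbb{A}_r))$, put $\iota(f)=\lim_{r\to1}w(f_r)$, which is well defined. The $\nu$-metric. Let $\mathbb{F}(H^\infty(\mathbb{D}))$ be the field of fractions of $H^\infty(\mathbb{D})$. A coprime factorisation of $p\in\mathbb{F}(H^\infty(\mathbb{D}))$ is $p=n/d$ with $n,d\in H^\infty(\mathbb{D})$, $d\ne0$,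 such that $nx+dy=1$ for some $x,y\in H^\infty(\mathbb{D})$. Let $\mathbb{S}(H^\infty(\mathbb{D}))$ be the set of $p\in\mathbb{F}(H^\infty(\mathbb{D}))$ having a coprime factorisation. For $p_1=n_1/d_1$ and $p_2=n_2/d_2$ in $\mathbb{S}(H^\infty(\mathbb{D}))$ (coprime factorisations), the chordal distance is $$\kappa(p_1,p_2)=\sup_{\varphi}\frac{|\widehat{n_1}(\varphi)\widehat{d_2}(\varphi)-\widehat{n_2}(\varphi)\widehat{d_1}(\varphi)|}{\sqrt{|\widehat{n_1}(\varphi)|^2+|\widehat{d_1}(\varphi)|^2}\sqrt{|\widehat{n_2}(\varphi)|^2+|\widehat{d_2}(\varphi)|^2}},$$ where $\varphi$ ranges over the maximal ideal space of $\varinjlim C_b(\mathbb{A}_r)$ and $\widehat{\cdot}$ is the Gelfand transform. Then $d(p_1,p_2)=\kappa(p_1,p_2)$ if $n_1^*n_2+d_1^*d_2\in\operatorname{inv}(\varinjlim C_b(\mathbb{A}_r))$ and $\iota(n_1^*n_2+d_1^*d_2)=0$, and $d(p_1,p_2)=1$ otherwise (this does not depend on the chosen coprime factorisations).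
   Formalization: The last supremum is corrected, as the printed one is false (e.g. a=0.1, ã near a): the numerator gains the factor |sinh(√y ζ)|, and the factors sinh(a√y ζ), sinh(ã√y ζ) are dropped from the two denominators. *)

theory Defs
  imports
    "HOL-Complex_Analysis.Complex_Analysis"
    "HOL-Computational_Algebra.Fraction_Field"
begin

section \<open>Bounded holomorphic functions on the disc\<close>

text \<open>Members are extended by \<open>0\<close> outside the disc, so that equality of functions
  is equality on the disc.\<close>

typedef hinf = "{f :: complex \<Rightarrow> complex. f holomorphic_on ball 0 1 \<and> bounded (f ` ball 0 1) \<and>
    (\<forall>z. z \<notin> ball 0 1 \<longrightarrow> f z = 0)}"
  morphisms hinf_fun Abs_hinf
  by (rule exI[of _ "\<lambda>_. 0"]) (auto simp: image_constant_conv)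

setup_lifting type_definition_hinf

lemma bounded_image_iff: "bounded (f ` S) \<longleftrightarrow> (\<exists>B. \<forall>z\<in>S. norm (f z) \<le> B)"
  by (simp add: bounded_iff)

lemma bounded_image_times:
  fixes f g :: "complex \<Rightarrow> complex"
  assumes "bounded (f ` S)" "bounded (g ` S)"
  shows "bounded ((\<lambda>z. f z * g z) ` S)"
proof -
  obtain B where B: "\<And>z. z \<in> S \<Longrightarrow> norm (f z) \<le> B"
    using assms(1) by (auto simp: bounded_image_iff)
  obtain C where C: "\<And>z. z \<in> S \<Longrightarrow> norm (g z) \<le> C"
    using assms(2) by (auto simp: bounded_image_iff)
  have "norm (f z * g z) \<le> B * C" if "z \<in> S" for z
    unfolding norm_mult using B[OF that] C[OF that]
    by (intro mult_mono) (auto intro: order_trans[OF norm_ge_zero])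
  then show ?thesis by (auto simp: bounded_image_iff)
qed

instantiation hinf :: idom
begin

lift_definition zero_hinf :: hinf is "\<lambda>_. 0"
  by (auto simp: image_constant_conv)
lift_definition one_hinf :: hinf is "\<lambda>z. if z \<in> ball 0 1 then 1 else 0"
proof (intro conjI)
  show "(\<lambda>z. if z \<in> ball 0 1 then 1 else 0) holomorphic_on ball (0::complex) 1"
    by (rule holomorphic_transform[of "\<lambda>_. 1"]) auto
qed (auto simp: bounded_image_iff)
lift_definition plus_hinf :: "hinf \<Rightarrow> hinf \<Rightarrow> hinf" is "\<lambda>f g z. f z + g z"
  by (auto intro!: holomorphic_intros bounded_plus_comp)
lift_definition minus_hinf :: "hinf \<Rightarrow> hinf \<Rightarrow> hinf" is "\<lambda>f g z. f z - g z"
  by (auto intro!: holomorphic_intros bounded_minus_comp)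
lift_definition uminus_hinf :: "hinf \<Rightarrow> hinf" is "\<lambda>f z. - f z"
  by (auto intro!: holomorphic_intros simp: bounded_image_iff)
lift_definition times_hinf :: "hinf \<Rightarrow> hinf \<Rightarrow> hinf" is "\<lambda>f g z. f z * g z"
  by (auto intro!: holomorphic_intros bounded_image_times)

instance
proof
  fix a b c :: hinf
  show "a * b * c = a * (b * c)" by transfer (simp add: mult.assoc)
  show "a * b = b * a" by transfer (simp add: mult.commute)
  show "1 * a = a" by transfer auto
  show "a + b + c = a + (b + c)" by transfer (simp add: add.assoc)
  show "a + b = b + a" by transfer (simp add: add.commute)
  show "0 + a = a" by transfer auto
  show "- a + a = 0" by transfer auto
  show "a - b = a + - b" by transfer auto
  show "(a + b) * c = a * c + b * c" by transfer (simp add: algebra_simps)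
  show "a * (b + c) = a * b + a * c" by transfer (simp add: algebra_simps)
  show "0 * a = 0" "a * 0 = 0" by (transfer, simp)+
  show "(0::hinf) \<noteq> 1" by transfer (auto dest: fun_cong[of _ _ 0])
  show "a * b \<noteq> 0" if "a \<noteq> 0" "b \<noteq> 0"
    using that
  proof transfer
    fix f g :: "complex \<Rightarrow> complex"
    let ?D = "ball (0::complex) 1"
    assume f: "f holomorphic_on ?D \<and> bounded (f ` ?D) \<and> (\<forall>z. z \<notin> ?D \<longrightarrow> f z = 0)"
      and g: "g holomorphic_on ?D \<and> bounded (g ` ?D) \<and> (\<forall>z. z \<notin> ?D \<longrightarrow> g z = 0)"
      and nz: "f \<noteq> (\<lambda>_. 0)" "g \<noteq> (\<lambda>_. 0)"
    obtain u where "f u \<noteq> 0" using nz(1) by blast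
    with f have u: "f u \<noteq> 0" "u \<in> ?D" by blast+
    obtain v where "g v \<noteq> 0" using nz(2) by blast
    with g have v: "g v \<noteq> 0" "v \<in> ?D" by blast+
    show "(\<lambda>z. f z * g z) \<noteq> (\<lambda>_. 0)"
    proof
      assume "(\<lambda>z. f z * g z) = (\<lambda>_. 0)"
      then have fg: "f z * g z = 0" for z by (rule fun_cong)
      have "continuous_on ?D f" using f by (simp add: holomorphic_on_imp_continuous_on)
      then have op: "open (?D \<inter> f -` (-{0}))"
        by (intro continuous_open_preimage) auto
      have "g v = 0"
      proof (rule analytic_continuation_open[of "?D \<inter> f -` (-{0})" ?D g "\<lambda>_. 0"])
        show "?D \<inter> f -` (-{0}) \<noteq> {}" using u by blast
        show "g holomorphic_on ?D" using g by blast
        show "g z = 0" if "z \<in> ?D \<inter> f -` (-{0})" for z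
          using fg[of z] that by simp
      qed (use op v(2) in \<open>simp_all add: convex_connected\<close>)
      with v show False by simp
    qed
  qed
qed

end

section \<open>The limit algebra\<close>

definition annulus :: "real \<Rightarrow> complex set" where
  "annulus r = {z. r < norm z \<and> norm z < 1}"

definition Cb :: "real \<Rightarrow> (complex \<Rightarrow> complex) set" where
  "Cb r = {f. continuous_on (annulus r) f \<and> bounded (f ` annulus r)}"

definition supnorm :: "real \<Rightarrow> (complex \<Rightarrow> complex) \<Rightarrow> real" where
  "supnorm r f = (SUP z\<in>annulus r. norm (f z))"

definition family :: "(real \<Rightarrow> complex \<Rightarrow> complex) set" where
  "family = {f. (\<forall>r\<in>{0<..<1}. f r \<in> Cb r) \<and>
     (\<exists>r0\<in>{0<..<1}. \<forall>r R. r0 \<le> r \<and> r \<le> R \<and> R < 1 \<longrightarrow> (\<forall>z\<in>annulus R. f r z = f R z))}"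

definition family_seminorm :: "(real \<Rightarrow> complex \<Rightarrow> complex) \<Rightarrow> real" where
  "family_seminorm f = Lim (at_left 1) (\<lambda>r. supnorm r (f r))"

definition limrel :: "(real \<Rightarrow> complex \<Rightarrow> complex) \<Rightarrow> (real \<Rightarrow> complex \<Rightarrow> complex) \<Rightarrow> bool" where
  "limrel f g \<longleftrightarrow> f \<in> family \<and> g \<in> family \<and> family_seminorm (\<lambda>r z. f r z - g r z) = 0"

lemma annulus_nonempty: "r < 1 \<Longrightarrow> annulus r \<noteq> {}"
proof -
  assume "r < 1"
  then obtain t where t: "max r 0 < t" "t < 1" using dense[of "max r 0" 1] by auto
  then have "complex_of_real t \<in> annulus r" by (auto simp: annulus_def)
  then show ?thesis by auto
qed

lemma annulus_mono: "r \<le> R \<Longrightarrow> annulus R \<subseteq> annulus r"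
  by (auto simp: annulus_def)

lemma Cb_const: "(\<lambda>_. c) \<in> Cb r"
  by (auto simp: Cb_def bounded_image_iff)

lemma Cb_add: "f \<in> Cb r \<Longrightarrow> g \<in> Cb r \<Longrightarrow> (\<lambda>z. f z + g z) \<in> Cb r"
  by (auto simp: Cb_def intro!: continuous_intros bounded_plus_comp)

lemma Cb_diff: "f \<in> Cb r \<Longrightarrow> g \<in> Cb r \<Longrightarrow> (\<lambda>z. f z - g z) \<in> Cb r"
  by (auto simp: Cb_def intro!: continuous_intros bounded_minus_comp)

lemma Cb_mult: "f \<in> Cb r \<Longrightarrow> g \<in> Cb r \<Longrightarrow> (\<lambda>z. f z * g z) \<in> Cb r"
  by (auto simp: Cb_def intro!: continuous_intros bounded_image_times)

lemma Cb_cnj: "f \<in> Cb r \<Longrightarrow> (\<lambda>z. cnj (f z)) \<in> Cb r"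
  by (auto simp: Cb_def bounded_image_iff intro!: continuous_intros)

lemma family_binop:
  assumes "f \<in> family" "g \<in> family"
    and "\<And>r. f r \<in> Cb r \<Longrightarrow> g r \<in> Cb r \<Longrightarrow> (\<lambda>z. h (f r z) (g r z)) \<in> Cb r"
  shows "(\<lambda>r z. h (f r z) (g r z)) \<in> family"
proof -
  obtain a where a: "a \<in> {0<..<1}"
      "\<And>r R z. a \<le> r \<Longrightarrow> r \<le> R \<Longrightarrow> R < 1 \<Longrightarrow> z \<in> annulus R \<Longrightarrow> f r z = f R z"
    using assms(1) unfolding family_def by blast
  obtain b where b: "b \<in> {0<..<1}"
      "\<And>r R z. b \<le> r \<Longrightarrow> r \<le> R \<Longrightarrow> R < 1 \<Longrightarrow> z \<in> annulus R \<Longrightarrow> g r z = g R z"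
    using assms(2) unfolding family_def by blast
  have "max a b \<in> {0<..<1}" using a b by auto
  moreover have "\<forall>r R. max a b \<le> r \<and> r \<le> R \<and> R < 1 \<longrightarrow>
      (\<forall>z\<in>annulus R. h (f r z) (g r z) = h (f R z) (g R z))"
    using a(2) b(2) by (metis max.bounded_iff)
  ultimately show ?thesis
    using assms unfolding family_def by blast
qed

lemma family_const: "(\<lambda>_ _. c) \<in> family"
proof -
  have "(1/2::real) \<in> {0<..<1}" by simp
  then show ?thesis unfolding family_def using Cb_const by blast
qed

lemmas family_add = family_binop[of _ _ "(+)", OF _ _ Cb_add]
lemmas family_diff = family_binop[of _ _ "(-)", OF _ _ Cb_diff]
lemmas family_mult = family_binop[of _ _ "(*)", OF _ _ Cb_mult]
lemmas family_cnj = family_binop[where h = "\<lambda>x _. cnj x", OF _ _ Cb_cnj]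

lemma Cb_le_supnorm:
  assumes "f \<in> Cb r" "z \<in> annulus r" shows "norm (f z) \<le> supnorm r f"
  unfolding supnorm_def
  using assms by (intro cSUP_upper) (auto simp: Cb_def bounded_image_iff bdd_above_def)

lemma supnorm_least:
  assumes "r < 1" "\<And>z. z \<in> annulus r \<Longrightarrow> norm (f z) \<le> B" shows "supnorm r f \<le> B"
  unfolding supnorm_def using assms annulus_nonempty by (intro cSUP_least) auto

lemma supnorm_nonneg: "f \<in> Cb r \<Longrightarrow> r < 1 \<Longrightarrow> 0 \<le> supnorm r f"
  using Cb_le_supnorm annulus_nonempty norm_ge_zero order_trans by (metis ex_in_conv)

lemma supnorm_eventually_antimono:
  assumes "f \<in> family"
  shows "\<exists>r0\<in>{0<..<1}. \<forall>r R. r0 \<le> r \<and> r \<le> R \<and> R < 1 \<longrightarrow> supnorm R (f R) \<le> supnorm r (f r)"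
proof -
  obtain a where a: "a \<in> {0<..<1}"
      "\<And>r R z. a \<le> r \<Longrightarrow> r \<le> R \<Longrightarrow> R < 1 \<Longrightarrow> z \<in> annulus R \<Longrightarrow> f r z = f R z"
    using assms unfolding family_def by blast
  have "supnorm R (f R) \<le> supnorm r (f r)" if "a \<le> r" "r \<le> R" "R < 1" for r R
  proof (rule supnorm_least[OF that(3)])
    fix z assume z: "z \<in> annulus R"
    have "f r \<in> Cb r" using assms that a(1) unfolding family_def by auto
    moreover have "z \<in> annulus r" using z annulus_mono[OF that(2)] by auto
    ultimately show "norm (f R z) \<le> supnorm r (f r)"
      using Cb_le_supnorm a(2)[OF that z] by metis
  qed
  with a(1) show ?thesis by blast
qed

lemma tendsto_family_seminorm:
  assumes "f \<in> family"
  shows "((\<lambda>r. supnorm r (f r)) \<longlongrightarrow> family_seminorm f) (at_left 1)"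
proof -
  obtain a where a: "a \<in> {0<..<1}"
    and mono: "\<And>r R. a \<le> r \<Longrightarrow> r \<le> R \<Longrightarrow> R < 1 \<Longrightarrow> supnorm R (f R) \<le> supnorm r (f r)"
    using supnorm_eventually_antimono[OF assms] by blast
  define L where "L = (INF r\<in>{a..<1}. supnorm r (f r))"
  have nonneg: "0 \<le> supnorm r (f r)" if "r \<in> {a..<1}" for r
    using that assms a by (intro supnorm_nonneg) (auto simp: family_def)
  have bdd: "bdd_below ((\<lambda>r. supnorm r (f r)) ` {a..<1})"
    by (rule bdd_belowI[of _ 0]) (use nonneg in auto)
  have "((\<lambda>r. supnorm r (f r)) \<longlongrightarrow> L) (at_left 1)"
  proof (rule decreasing_tendsto)
    have "\<forall>\<^sub>F r in at_left 1. r \<in> {a<..<1}"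
      using a by (intro eventually_at_left_real) auto
    then show "\<forall>\<^sub>F r in at_left 1. L \<le> supnorm r (f r)"
      unfolding L_def by eventually_elim (rule cINF_lower[OF bdd], auto)
  next
    fix x assume "L < x"
    moreover have "{a..<1} \<noteq> {}" using a by auto
    ultimately obtain r where r: "r \<in> {a..<1}" "supnorm r (f r) < x"
      unfolding L_def using cINF_less_iff[OF _ bdd] by blast
    have "\<forall>\<^sub>F R in at_left 1. R \<in> {r<..<1}"
      using r by (intro eventually_at_left_real) auto
    then show "\<forall>\<^sub>F R in at_left 1. supnorm R (f R) < x"
    proof eventually_elim
      case (elim R)
      with mono[of r R] r show ?case by auto
    qed
  qed
  moreover have "family_seminorm f = L"
    unfolding family_seminorm_def using calculation
    by (intro tendsto_Lim) (auto simp: trivial_limit_at_left_real)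
  ultimately show ?thesis by simp
qed

lemma tendsto_imp_family_seminorm:
  "((\<lambda>r. supnorm r (f r)) \<longlongrightarrow> L) (at_left 1) \<Longrightarrow> family_seminorm f = L"
  unfolding family_seminorm_def by (intro tendsto_Lim) (auto simp: trivial_limit_at_left_real)

lemma family_seminorm_dominated:
  assumes f: "f \<in> family" and k: "k \<in> family" and l: "l \<in> family"
    and "family_seminorm k = 0" "family_seminorm l = 0"
    and le: "\<And>r z. r \<in> {0<..<1} \<Longrightarrow> z \<in> annulus r \<Longrightarrow> norm (f r z) \<le> B * norm (k r z) + C * norm (l r z)"
    and "0 \<le> B" "0 \<le> C"
  shows "family_seminorm f = 0"
proof (rule tendsto_imp_family_seminorm)
  have ev: "\<forall>\<^sub>F r in at_left 1. r \<in> {0<..<1::real}"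
    by (rule eventually_at_left_real) simp
  have "((\<lambda>r. B * supnorm r (k r) + C * supnorm r (l r)) \<longlongrightarrow> B * 0 + C * 0) (at_left 1)"
    using tendsto_family_seminorm[OF k] tendsto_family_seminorm[OF l] assms(4,5)
    by (intro tendsto_intros) auto
  then have lim: "((\<lambda>r. B * supnorm r (k r) + C * supnorm r (l r)) \<longlongrightarrow> 0) (at_left 1)" by simp
  show "((\<lambda>r. supnorm r (f r)) \<longlongrightarrow> 0) (at_left 1)"
  proof (rule tendsto_sandwich[OF _ _ tendsto_const lim])
    show "\<forall>\<^sub>F r in at_left 1. 0 \<le> supnorm r (f r)"
      using ev by eventually_elim (use f in \<open>auto intro: supnorm_nonneg simp: family_def\<close>)
    show "\<forall>\<^sub>F r in at_left 1. supnorm r (f r) \<le> B * supnorm r (k r) + C * supnorm r (l r)"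
      using ev
    proof eventually_elim
      case (elim r)
      show ?case
      proof (rule supnorm_least)
        fix z assume z: "z \<in> annulus r"
        have "norm (k r z) \<le> supnorm r (k r)" "norm (l r z) \<le> supnorm r (l r)"
          using elim z k l by (auto intro!: Cb_le_supnorm simp: family_def)
        then have "B * norm (k r z) + C * norm (l r z) \<le> B * supnorm r (k r) + C * supnorm r (l r)"
          using assms by (intro add_mono mult_left_mono) auto
        with le[OF elim z] show "norm (f r z) \<le> B * supnorm r (k r) + C * supnorm r (l r)" by simp
      qed (use elim in auto)
    qed
  qed
qed

lemma family_seminorm_const: "family_seminorm (\<lambda>_ _. c) = norm c"
proof (rule tendsto_imp_family_seminorm)
  have "\<forall>\<^sub>F r in at_left 1. r \<in> {0<..<1::real}"
    by (rule eventually_at_left_real) simp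
  then have "\<forall>\<^sub>F r in at_left 1. supnorm r (\<lambda>_. c) = norm c"
    by eventually_elim (use annulus_nonempty in \<open>auto simp: supnorm_def\<close>)
  then show "((\<lambda>r. supnorm r (\<lambda>_. c)) \<longlongrightarrow> norm c) (at_left 1)"
    by (rule tendsto_eventually)
qed

lemma family_bounded:
  assumes "f \<in> family"
  obtains B r0 where "r0 \<in> {0<..<1}" "0 \<le> B"
    "\<And>r z. r0 \<le> r \<Longrightarrow> r < 1 \<Longrightarrow> z \<in> annulus r \<Longrightarrow> norm (f r z) \<le> B"
proof -
  obtain a where a: "a \<in> {0<..<1}"
    and mono: "\<And>r R. a \<le> r \<Longrightarrow> r \<le> R \<Longrightarrow> R < 1 \<Longrightarrow> supnorm R (f R) \<le> supnorm r (f r)"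
    using supnorm_eventually_antimono[OF assms] by blast
  have "norm (f r z) \<le> supnorm a (f a)" if "a \<le> r" "r < 1" "z \<in> annulus r" for r z
  proof -
    have "norm (f r z) \<le> supnorm r (f r)"
      using assms that a by (intro Cb_le_supnorm) (auto simp: family_def)
    with mono[of a r] that show ?thesis by auto
  qed
  moreover have "0 \<le> supnorm a (f a)"
    using assms a by (intro supnorm_nonneg) (auto simp: family_def)
  ultimately show ?thesis using that a by blast
qed

lemma limrel_refl: "f \<in> family \<Longrightarrow> limrel f f"
  using family_seminorm_const[of 0] by (simp add: limrel_def)

lemma limrel_memD: "limrel f g \<Longrightarrow> f \<in> family" "limrel f g \<Longrightarrow> g \<in> family"
  by (auto simp: limrel_def)

lemma limrel_sym: "limrel f g \<Longrightarrow> limrel g f"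
  unfolding limrel_def supnorm_def family_seminorm_def by (simp add: norm_minus_commute)

lemma limrel_add_general:
  assumes "limrel f f'" "limrel g g'" "h \<in> family" "h' \<in> family" "0 \<le> B" "0 \<le> C"
    and "\<And>r z. r \<in> {0<..<1} \<Longrightarrow> z \<in> annulus r \<Longrightarrow>
           norm (h r z - h' r z) \<le> B * norm (f r z - f' r z) + C * norm (g r z - g' r z)"
  shows "limrel h h'"
  unfolding limrel_def
proof (intro conjI assms)
  show "family_seminorm (\<lambda>r z. h r z - h' r z) = 0"
    by (rule family_seminorm_dominated[OF _ _ _ _ _ assms(7,5,6)])
       (use assms in \<open>auto simp: limrel_def intro!: family_diff\<close>)
qed

quotient_type limalg = "real \<Rightarrow> complex \<Rightarrow> complex" / partial: limrel
proof (rule part_equivpI)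
  show "\<exists>f. limrel f f" using limrel_refl family_const by blast
  show "symp limrel" by (rule sympI) (rule limrel_sym)
  show "transp limrel"
  proof (rule transpI)
    fix f g h assume *: "limrel f g" "limrel g h"
    show "limrel f h"
    proof (rule limrel_add_general[OF *, of _ _ 1 1])
      fix r z
      have "f r z - h r z = (f r z - g r z) + (g r z - h r z)" by simp
      then show "norm (f r z - h r z) \<le> 1 * norm (f r z - g r z) + 1 * norm (g r z - h r z)"
        by (metis mult_1 norm_triangle_ineq)
    qed (use * limrel_memD in auto)
  qed
qed

lemma limrel_add: "limrel f f' \<Longrightarrow> limrel g g' \<Longrightarrow> limrel (\<lambda>r z. f r z + g r z) (\<lambda>r z. f' r z + g' r z)"
  by (rule limrel_add_general[of f f' g g' _ _ 1 1])
     (auto intro: family_add limrel_memD norm_diff_triangle_ineq)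

lemma limrel_minus: "limrel f f' \<Longrightarrow> limrel g g' \<Longrightarrow> limrel (\<lambda>r z. f r z - g r z) (\<lambda>r z. f' r z - g' r z)"
proof (rule limrel_add_general[of f f' g g' _ _ 1 1])
  fix r z
  have "f r z - g r z - (f' r z - g' r z) = (f r z - f' r z) - (g r z - g' r z)" by simp
  then show "norm (f r z - g r z - (f' r z - g' r z)) \<le> 1 * norm (f r z - f' r z) + 1 * norm (g r z - g' r z)"
    by (metis mult_1 norm_triangle_ineq4)
qed (auto intro: family_diff limrel_memD)

lemma limrel_cnj: "limrel f f' \<Longrightarrow> limrel (\<lambda>r z. cnj (f r z)) (\<lambda>r z. cnj (f' r z))"
proof (rule limrel_add_general[of f f' f f' _ _ 1 0])
  show "norm (cnj (f r z) - cnj (f' r z)) \<le> 1 * norm (f r z - f' r z) + 0 * norm (f r z - f' r z)" for r z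
    by (simp flip: complex_cnj_diff)
qed (auto intro: family_cnj limrel_memD)

lemma limrel_mult:
  assumes "limrel f f'" "limrel g g'"
  shows "limrel (\<lambda>r z. f r z * g r z) (\<lambda>r z. f' r z * g' r z)"
proof -
  have mem: "f \<in> family" "f' \<in> family" "g \<in> family" "g' \<in> family"
    using assms limrel_memD by auto
  obtain B a where B: "a \<in> {0<..<1}" "0 \<le> B"
      "\<And>r z. a \<le> r \<Longrightarrow> r < 1 \<Longrightarrow> z \<in> annulus r \<Longrightarrow> norm (f r z) \<le> B"
    using family_bounded[OF mem(1)] by metis
  obtain C b where C: "b \<in> {0<..<1}" "0 \<le> C"
      "\<And>r z. b \<le> r \<Longrightarrow> r < 1 \<Longrightarrow> z \<in> annulus r \<Longrightarrow> norm (g' r z) \<le> C"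
    using family_bounded[OF mem(4)] by metis
  have fam: "(\<lambda>r z. f r z * g r z) \<in> family" "(\<lambda>r z. f' r z * g' r z) \<in> family"
    "(\<lambda>r z. f r z - f' r z) \<in> family" "(\<lambda>r z. g r z - g' r z) \<in> family"
    using mem by (auto intro: family_mult family_diff)
  let ?h = "\<lambda>r z. f r z * g r z - f' r z * g' r z"
  have hfam: "?h \<in> family" using fam by (auto intro: family_diff)
  have ev: "\<forall>\<^sub>F r in at_left 1. r \<in> {max a b<..<1::real}"
    using B C by (intro eventually_at_left_real) auto
  have "((\<lambda>r. B * supnorm r (\<lambda>z. g r z - g' r z) + C * supnorm r (\<lambda>z. f r z - f' r z))
      \<longlongrightarrow> B * 0 + C * 0) (at_left 1)"
    using tendsto_family_seminorm[OF fam(3)] tendsto_family_seminorm[OF fam(4)] assms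
    by (intro tendsto_intros) (auto simp: limrel_def)
  then have lim: "((\<lambda>r. B * supnorm r (\<lambda>z. g r z - g' r z) + C * supnorm r (\<lambda>z. f r z - f' r z))
      \<longlongrightarrow> 0) (at_left 1)" by simp
  have "((\<lambda>r. supnorm r (?h r)) \<longlongrightarrow> 0) (at_left 1)"
  proof (rule tendsto_sandwich[OF _ _ tendsto_const lim])
    show "\<forall>\<^sub>F r in at_left 1. 0 \<le> supnorm r (?h r)"
      using ev by eventually_elim (use hfam B C in \<open>auto intro!: supnorm_nonneg simp: family_def\<close>)
    show "\<forall>\<^sub>F r in at_left 1. supnorm r (?h r) \<le>
        B * supnorm r (\<lambda>z. g r z - g' r z) + C * supnorm r (\<lambda>z. f r z - f' r z)"
      using ev
    proof eventually_elim
      case (elim r)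
      show ?case
      proof (rule supnorm_least)
        fix z assume z: "z \<in> annulus r"
        have cb: "(\<lambda>z. g r z - g' r z) \<in> Cb r" "(\<lambda>z. f r z - f' r z) \<in> Cb r"
          using fam(3,4) elim B C by (auto simp: family_def)
        have "?h r z = f r z * (g r z - g' r z) + g' r z * (f r z - f' r z)"
          by (simp add: algebra_simps)
        then have "norm (?h r z) \<le> norm (f r z) * norm (g r z - g' r z) + norm (g' r z) * norm (f r z - f' r z)"
          by (metis norm_mult norm_triangle_ineq)
        also have "\<dots> \<le> B * supnorm r (\<lambda>z. g r z - g' r z) + C * supnorm r (\<lambda>z. f r z - f' r z)"
          using elim z B C Cb_le_supnorm[OF cb(1) z] Cb_le_supnorm[OF cb(2) z]
          by (intro add_mono mult_mono) auto
        finally show "norm (?h r z) \<le> B * supnorm r (\<lambda>z. g r z - g' r z) + C * supnorm r (\<lambda>z. f r z - f' r z)" .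
      qed (use elim in auto)
    qed
  qed
  then have "family_seminorm ?h = 0" by (rule tendsto_imp_family_seminorm)
  with fam show ?thesis by (simp add: limrel_def)
qed

instantiation limalg :: comm_ring_1
begin

lift_definition zero_limalg :: limalg is "\<lambda>_ _. 0"
  by (rule limrel_refl[OF family_const])
lift_definition one_limalg :: limalg is "\<lambda>_ _. 1"
  by (rule limrel_refl[OF family_const])
lift_definition plus_limalg :: "limalg \<Rightarrow> limalg \<Rightarrow> limalg" is "\<lambda>f g r z. f r z + g r z"
  by (rule limrel_add)
lift_definition minus_limalg :: "limalg \<Rightarrow> limalg \<Rightarrow> limalg" is "\<lambda>f g r z. f r z - g r z"
  by (rule limrel_minus)
lift_definition uminus_limalg :: "limalg \<Rightarrow> limalg" is "\<lambda>f r z. - f r z"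
  using limrel_minus[OF limrel_refl[OF family_const[of 0]]] by simp
lift_definition times_limalg :: "limalg \<Rightarrow> limalg \<Rightarrow> limalg" is "\<lambda>f g r z. f r z * g r z"
  by (rule limrel_mult)

instance
proof
  fix a b c :: limalg
  show "a * b * c = a * (b * c)"
    by transfer (auto simp: mult.assoc intro!: limrel_refl family_mult dest: limrel_memD)
  show "a * b = b * a"
    by transfer (auto simp: mult.commute intro!: limrel_refl family_mult dest: limrel_memD)
  show "1 * a = a" by transfer (auto dest: limrel_memD intro: limrel_refl)
  show "a + b + c = a + (b + c)"
    by transfer (auto simp: add.assoc intro!: limrel_refl family_add dest: limrel_memD)
  show "a + b = b + a"
    by transfer (auto simp: add.commute intro!: limrel_refl family_add dest: limrel_memD)
  show "0 + a = a" by transfer (auto dest: limrel_memD intro: limrel_refl)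
  show "- a + a = 0" by transfer (auto intro!: limrel_refl family_const)
  show "a - b = a + - b"
    by transfer (auto intro!: limrel_refl family_diff dest: limrel_memD)
  show "(a + b) * c = a * c + b * c"
    by transfer (auto simp: distrib_right intro!: limrel_refl family_add family_mult dest: limrel_memD)
  show "(0::limalg) \<noteq> 1"
    by transfer (auto simp: limrel_def family_seminorm_const)
qed

end

lift_definition scale_limalg :: "complex \<Rightarrow> limalg \<Rightarrow> limalg" is "\<lambda>c f r z. c * f r z"
  by (rule limrel_mult[OF limrel_refl[OF family_const]])

lift_definition star_limalg :: "limalg \<Rightarrow> limalg" is "\<lambda>f r z. cnj (f r z)"
  by (rule limrel_cnj)

lift_definition limalg_of_hinf :: "hinf \<Rightarrow> limalg" is "\<lambda>f _. f"
proof (rule limrel_refl)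
  fix f :: "complex \<Rightarrow> complex"
  assume f: "f holomorphic_on ball 0 1 \<and> bounded (f ` ball 0 1) \<and> (\<forall>z. z \<notin> ball 0 1 \<longrightarrow> f z = 0)"
  have "annulus r \<subseteq> ball 0 1" for r by (auto simp: annulus_def)
  moreover have "continuous_on (ball 0 1) f" using f by (simp add: holomorphic_on_imp_continuous_on)
  ultimately have "f \<in> Cb r" for r
    using f unfolding Cb_def mem_Collect_eq
    by (metis continuous_on_subset bounded_subset image_mono)
  moreover have "(1/2::real) \<in> {0<..<1}" by simp
  ultimately show "(\<lambda>_. f) \<in> family" unfolding family_def by blast
qed

section \<open>The index\<close>

text \<open>The index of an element is taken along an arbitrary representing family.\<close>

definition annulus_winding :: "real \<Rightarrow> (complex \<Rightarrow> complex) \<Rightarrow> int" where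
  "annulus_winding \<rho> f =
     (THE n. \<forall>r\<in>{\<rho><..<1}. winding_number (f \<circ> circlepath 0 r) 0 = of_int n)"

definition index :: "limalg \<Rightarrow> int" where
  "index F = Lim (at_left 1) (\<lambda>r. annulus_winding r (rep_limalg F r))"

section \<open>Maximal ideal space and Gelfand transform\<close>

definition max_ideal_space :: "(limalg \<Rightarrow> complex) set" where
  "max_ideal_space = {\<phi>. \<phi> \<noteq> (\<lambda>_. 0) \<and>
     (\<forall>F G. \<phi> (F + G) = \<phi> F + \<phi> G) \<and> (\<forall>F G. \<phi> (F * G) = \<phi> F * \<phi> G) \<and>
     (\<forall>c F. \<phi> (scale_limalg c F) = c * \<phi> F)}"

definition gelfand :: "limalg \<Rightarrow> (limalg \<Rightarrow> complex) \<Rightarrow> complex" where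
  "gelfand F \<phi> = \<phi> F"

section \<open>The nu-metric\<close>

definition coprime_factorisation :: "hinf fract \<Rightarrow> hinf \<Rightarrow> hinf \<Rightarrow> bool" where
  "coprime_factorisation p n d \<longleftrightarrow> d \<noteq> 0 \<and> p = Fract n d \<and> (\<exists>x y. n * x + d * y = 1)"

definition stabilisable :: "hinf fract set" where
  "stabilisable = {p. \<exists>n d. coprime_factorisation p n d}"

text \<open>The quotient whose supremum is the chordal distance, as a function of the
  values \<open>n\<^sub>1, d\<^sub>1, n\<^sub>2, d\<^sub>2\<close>.\<close>

definition chordal_quotient :: "complex \<Rightarrow> complex \<Rightarrow> complex \<Rightarrow> complex \<Rightarrow> real" where
  "chordal_quotient n1 d1 n2 d2 =
     norm (n1 * d2 - n2 * d1) /
       (sqrt ((norm n1)\<^sup>2 + (norm d1)\<^sup>2) * sqrt ((norm n2)\<^sup>2 + (norm d2)\<^sup>2))"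

definition graph_pairing :: "hinf \<Rightarrow> hinf \<Rightarrow> hinf \<Rightarrow> hinf \<Rightarrow> limalg" where
  "graph_pairing n1 d1 n2 d2 =
     star_limalg (limalg_of_hinf n1) * limalg_of_hinf n2 +
     star_limalg (limalg_of_hinf d1) * limalg_of_hinf d2"

definition chordal_fact :: "hinf \<Rightarrow> hinf \<Rightarrow> hinf \<Rightarrow> hinf \<Rightarrow> real" where
  "chordal_fact n1 d1 n2 d2 = (SUP \<phi>\<in>max_ideal_space.
     chordal_quotient (gelfand (limalg_of_hinf n1) \<phi>) (gelfand (limalg_of_hinf d1) \<phi>)
       (gelfand (limalg_of_hinf n2) \<phi>) (gelfand (limalg_of_hinf d2) \<phi>))"

definition nu_fact :: "hinf \<Rightarrow> hinf \<Rightarrow> hinf \<Rightarrow> hinf \<Rightarrow> real" where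
  "nu_fact n1 d1 n2 d2 =
     (if graph_pairing n1 d1 n2 d2 dvd 1 \<and> index (graph_pairing n1 d1 n2 d2) = 0
      then chordal_fact n1 d1 n2 d2 else 1)"

text \<open>The following two are meaningful on \<^const>\<open>stabilisable\<close> plants only; the values do not
  depend on the coprime factorisations picked.\<close>

definition chordal_dist :: "hinf fract \<Rightarrow> hinf fract \<Rightarrow> real" where
  "chordal_dist p1 p2 = (SOME \<delta>. \<exists>n1 d1 n2 d2.
     coprime_factorisation p1 n1 d1 \<and> coprime_factorisation p2 n2 d2 \<and> \<delta> = chordal_fact n1 d1 n2 d2)"

definition nu_dist :: "hinf fract \<Rightarrow> hinf fract \<Rightarrow> real" where
  "nu_dist p1 p2 = (SOME \<delta>. \<exists>n1 d1 n2 d2.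
     coprime_factorisation p1 n1 d1 \<and> coprime_factorisation p2 n2 d2 \<and> \<delta> = nu_fact n1 d1 n2 d2)"

section \<open>Passage from the half-plane to the disc\<close>

definition hinf_half_plane :: "(complex \<Rightarrow> complex) set" where
  "hinf_half_plane = {f. f holomorphic_on {s. Re s > 0} \<and> bounded (f ` {s. Re s > 0})}"

text \<open>Only meaningful for members of \<^const>\<open>hinf_half_plane\<close>.\<close>

definition to_disc :: "(complex \<Rightarrow> complex) \<Rightarrow> hinf" where
  "to_disc f = Abs_hinf (\<lambda>z. if z \<in> ball 0 1 then f ((1 + z) / (1 - z)) else 0)"

lemma Re_cayley_pos:
  assumes "z \<in> ball (0::complex) 1" shows "Re ((1 + z) / (1 - z)) > 0"
proof -
  have z: "norm z < 1" using assms by simp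
  then have nz: "1 - z \<noteq> 0" by auto
  have "(norm z)\<^sup>2 < 1" using z by (simp add: abs_square_less_1)
  then have "(Re z)\<^sup>2 + (Im z)\<^sup>2 < 1" by (simp only: cmod_power2)
  then have "(1 + Re z) * (1 - Re z) - Im z * Im z > 0"
    by (simp add: power2_eq_square algebra_simps)
  moreover have "(Re (1 - z))\<^sup>2 + (Im (1 - z))\<^sup>2 > 0"
    using nz by (metis complex_neq_0)
  ultimately show ?thesis by (simp add: Re_divide algebra_simps)
qed

lemma hinf_fun_to_disc:
  assumes "f \<in> hinf_half_plane"
  shows "hinf_fun (to_disc f) = (\<lambda>z. if z \<in> ball 0 1 then f ((1 + z) / (1 - z)) else 0)"
  unfolding to_disc_def
proof (rule Abs_hinf_inverse, safe)
  have "(\<lambda>z. f ((1 + z) / (1 - z))) holomorphic_on ball 0 1"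
  proof (rule holomorphic_on_compose_gen[where g = f, unfolded o_def])
    show "(\<lambda>z. (1 + z) / (1 - z)) holomorphic_on ball 0 (1::real)"
      by (intro holomorphic_intros) auto
    show "f holomorphic_on {s. Re s > 0}" using assms by (simp add: hinf_half_plane_def)
  qed (use Re_cayley_pos in blast)
  then show "(\<lambda>z. if z \<in> ball 0 1 then f ((1 + z) / (1 - z)) else 0) holomorphic_on ball 0 1"
    by (rule holomorphic_transform) auto
  have "(\<lambda>z. if z \<in> ball 0 1 then f ((1 + z) / (1 - z)) else 0) ` ball 0 1 \<subseteq> f ` {s. Re s > 0}"
    using Re_cayley_pos by auto
  then show "bounded ((\<lambda>z. if z \<in> ball 0 1 then f ((1 + z) / (1 - z)) else 0) ` ball 0 1)"
    using assms bounded_subset by (auto simp: hinf_half_plane_def)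
qed auto

section \<open>The plants\<close>

definition n_fun :: "real \<Rightarrow> complex \<Rightarrow> complex" where
  "n_fun a s = 1 / (csqrt s + 1) * (sinh (of_real a * csqrt s) / sinh (csqrt s))"

definition d_fun :: "real \<Rightarrow> complex \<Rightarrow> complex" where
  "d_fun a s = csqrt s / (csqrt s + 1) * (sinh (of_real a * csqrt s) / cosh (of_real a * csqrt s))"

definition p_fun :: "real \<Rightarrow> complex \<Rightarrow> complex" where
  "p_fun a s = cosh (of_real a * csqrt s) / (csqrt s * sinh (csqrt s))"

lemma csqrt_sector:
  assumes "Re s > 0" shows "Re (csqrt s) > 0" "\<bar>Im (csqrt s)\<bar> \<le> Re (csqrt s)"
proof -
  have sq: "(csqrt s)\<^sup>2 = s" by simp
  have re: "(Re (csqrt s))\<^sup>2 - (Im (csqrt s))\<^sup>2 > 0"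
    using assms arg_cong[OF sq, of Re] unfolding Re_power2 by simp
  then show "\<bar>Im (csqrt s)\<bar> \<le> Re (csqrt s)"
    using Re_csqrt[of s] abs_le_square_iff[of "Im (csqrt s)" "Re (csqrt s)"] by simp
  have "Re (csqrt s) \<noteq> 0"
  proof
    assume "Re (csqrt s) = 0"
    with re have "0\<^sup>2 - (Im (csqrt s))\<^sup>2 > 0" by (simp only:)
    moreover have "(Im (csqrt s))\<^sup>2 \<ge> 0" by (rule zero_le_power2)
    ultimately show False by simp
  qed
  then show "Re (csqrt s) > 0" using Re_csqrt[of s] by linarith
qed

lemma norm_sinh_squared: "(norm (sinh z))\<^sup>2 = (sinh (Re z))\<^sup>2 + (sin (Im z))\<^sup>2" for z :: complex
proof -
  have "Re (sinh z) = sinh (Re z) * cos (Im z)" "Im (sinh z) = cosh (Re z) * sin (Im z)"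
    by (simp_all add: sinh_field_def cosh_field_def Re_exp Im_exp field_simps)
  then have "(norm (sinh z))\<^sup>2 = (sinh (Re z))\<^sup>2 * (cos (Im z))\<^sup>2 + (cosh (Re z))\<^sup>2 * (sin (Im z))\<^sup>2"
    by (simp only: cmod_power2 power_mult_distrib)
  also have "\<dots> = (sinh (Re z))\<^sup>2 + (sin (Im z))\<^sup>2"
    unfolding cosh_square_eq cos_squared_eq by (simp add: algebra_simps)
  finally show ?thesis .
qed

lemma norm_cosh_squared: "(norm (cosh z))\<^sup>2 = (sinh (Re z))\<^sup>2 + (cos (Im z))\<^sup>2" for z :: complex
proof -
  have "Re (cosh z) = cosh (Re z) * cos (Im z)" "Im (cosh z) = sinh (Re z) * sin (Im z)"
    by (simp_all add: sinh_field_def cosh_field_def Re_exp Im_exp field_simps)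
  then have "(norm (cosh z))\<^sup>2 = (cosh (Re z))\<^sup>2 * (cos (Im z))\<^sup>2 + (sinh (Re z))\<^sup>2 * (sin (Im z))\<^sup>2"
    by (simp only: cmod_power2 power_mult_distrib)
  also have "\<dots> = (sinh (Re z))\<^sup>2 + (cos (Im z))\<^sup>2"
    unfolding cosh_square_eq sin_squared_eq by (simp add: algebra_simps)
  finally show ?thesis .
qed

lemma sector_bounds:
  fixes w :: complex
  assumes "Re w > 0" "\<bar>Im w\<bar> \<le> Re w" "0 < a" "a < 1"
  shows "sinh w \<noteq> 0" "cosh (of_real a * w) \<noteq> 0"
    "norm (sinh (of_real a * w)) \<le> sqrt 2 * norm (sinh w)"
    "norm (sinh (of_real a * w)) \<le> sqrt 2 * norm (cosh (of_real a * w))"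
proof -
  have aw: "a * Re w > 0" "a * Re w \<le> Re w" using assms by (auto simp: mult_le_cancel_right1)
  have pos: "sinh (Re w) > 0" "sinh (a * Re w) > 0" using assms aw by auto
  have "(norm (sinh w))\<^sup>2 \<ge> (sinh (Re w))\<^sup>2" by (simp add: norm_sinh_squared)
  with pos show "sinh w \<noteq> 0" by auto
  have cosh: "(norm (cosh (of_real a * w)))\<^sup>2 \<ge> (sinh (a * Re w))\<^sup>2" by (simp add: norm_cosh_squared)
  with pos show "cosh (of_real a * w) \<noteq> 0" by auto
  have "\<bar>sin (a * Im w)\<bar> \<le> \<bar>a * Im w\<bar>" by (rule abs_sin_x_le_abs_x)
  also have "\<dots> \<le> a * Re w" using assms by (simp add: abs_mult)
  also have "\<dots> \<le> sinh (a * Re w)" using real_le_abs_sinh[of "a * Re w"] aw pos by (simp add: sinh_field_def exp_minus)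
  finally have "(sin (a * Im w))\<^sup>2 \<le> (sinh (a * Re w))\<^sup>2"
    using pos by (simp flip: abs_le_square_iff)
  then have key: "(norm (sinh (of_real a * w)))\<^sup>2 \<le> 2 * (sinh (a * Re w))\<^sup>2"
    by (simp add: norm_sinh_squared)
  have "(sinh (a * Re w))\<^sup>2 \<le> (sinh (Re w))\<^sup>2" using pos aw by (intro power_mono) auto
  also have "\<dots> \<le> (norm (sinh w))\<^sup>2" by (simp add: norm_sinh_squared)
  finally have "(norm (sinh (of_real a * w)))\<^sup>2 \<le> (sqrt 2 * norm (sinh w))\<^sup>2"
    using key by (simp add: power_mult_distrib)
  then show "norm (sinh (of_real a * w)) \<le> sqrt 2 * norm (sinh w)"
    by (rule power2_le_imp_le) auto
  have "(norm (sinh (of_real a * w)))\<^sup>2 \<le> (sqrt 2 * norm (cosh (of_real a * w)))\<^sup>2"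
    using key cosh by (simp add: power_mult_distrib)
  then show "norm (sinh (of_real a * w)) \<le> sqrt 2 * norm (cosh (of_real a * w))"
    by (rule power2_le_imp_le) auto
qed

lemma n_fun_d_fun_in_hinf_half_plane:
  assumes "0 < a" "a < 1"
  shows "n_fun a \<in> hinf_half_plane" "d_fun a \<in> hinf_half_plane"
proof -
  have sec: "sinh (csqrt s) \<noteq> 0" "cosh (of_real a * csqrt s) \<noteq> 0"
    "norm (sinh (of_real a * csqrt s)) \<le> sqrt 2 * norm (sinh (csqrt s))"
    "norm (sinh (of_real a * csqrt s)) \<le> sqrt 2 * norm (cosh (of_real a * csqrt s))"
    if "Re s > 0" for s
    using sector_bounds[OF csqrt_sector[OF that] assms] by auto
  have nz: "norm (csqrt s + 1) \<ge> 1" "norm (csqrt s) \<le> norm (csqrt s + 1)" "csqrt s + 1 \<noteq> 0"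
    if "Re s > 0" for s
  proof -
    have r: "Re (csqrt s) > 0" using csqrt_sector that by auto
    have "Re (csqrt s + 1) \<le> norm (csqrt s + 1)" by (rule complex_Re_le_cmod)
    moreover have "Re (csqrt s + 1) = Re (csqrt s) + 1" by (simp only: plus_complex.sel one_complex.sel)
    ultimately show "norm (csqrt s + 1) \<ge> 1" using r by linarith
    then show "csqrt s + 1 \<noteq> 0" by auto
    have "norm w \<le> norm (w + 1)" if "Re w > 0" for w :: complex
      using that by (simp add: cmod_def power2_eq_square algebra_simps)
    with r show "norm (csqrt s) \<le> norm (csqrt s + 1)" by blast
  qed
  have sl: "s \<notin> \<real>\<^sub>\<le>\<^sub>0" if "Re s > 0" for s :: complex
    using that by (auto simp: complex_nonpos_Reals_iff)
  have hol: "csqrt holomorphic_on {s. Re s > 0}"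
    using sl by (intro holomorphic_on_csqrt') auto
  have sinh_hol: "(\<lambda>s. sinh (c * csqrt s)) holomorphic_on {s. Re s > 0}"
    and cosh_hol: "(\<lambda>s. cosh (c * csqrt s)) holomorphic_on {s. Re s > 0}" for c :: complex
    unfolding sinh_field_def cosh_field_def by (intro holomorphic_intros hol; simp)+
  have "n_fun a holomorphic_on {s. Re s > 0}"
    unfolding n_fun_def using sec nz sinh_hol[of 1]
    by (intro holomorphic_intros hol sinh_hol) auto
  moreover have "norm (n_fun a s) \<le> 1 * sqrt 2" if "Re s > 0" for s
    unfolding n_fun_def norm_mult using sec[OF that] nz[OF that]
    by (intro mult_mono) (auto simp: norm_divide divide_simps)
  ultimately show "n_fun a \<in> hinf_half_plane"
    unfolding hinf_half_plane_def bounded_image_iff by auto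
  have "d_fun a holomorphic_on {s. Re s > 0}"
    unfolding d_fun_def using sec nz
    by (intro holomorphic_intros hol sinh_hol cosh_hol) auto
  moreover have "norm (d_fun a s) \<le> 1 * sqrt 2" if "Re s > 0" for s
    unfolding d_fun_def norm_mult using sec[OF that] nz[OF that]
    by (intro mult_mono) (auto simp: norm_divide divide_simps)
  ultimately show "d_fun a \<in> hinf_half_plane"
    unfolding hinf_half_plane_def bounded_image_iff by auto
qed

lemma chordal_quotient_scale:
  assumes "c1 \<noteq> 0" "c2 \<noteq> 0"
  shows "chordal_quotient (c1 * n1) (c1 * d1) (c2 * n2) (c2 * d2) = chordal_quotient n1 d1 n2 d2"
proof -
  have num: "norm (c1 * n1 * (c2 * d2) - c2 * n2 * (c1 * d1)) = (norm c1 * norm c2) * norm (n1 * d2 - n2 * d1)"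
    by (simp flip: norm_mult add: algebra_simps)
  have den: "sqrt ((norm (c * n))\<^sup>2 + (norm (c * d))\<^sup>2) = norm c * sqrt ((norm n)\<^sup>2 + (norm d)\<^sup>2)"
    for c n d :: complex
    by (simp add: norm_mult power_mult_distrib real_sqrt_mult flip: distrib_left)
  show ?thesis unfolding chordal_quotient_def num den using assms by simp
qed

text \<open>Since \<open>p_fun a s = cosh (a w) / (w sinh w)\<close> with \<open>w = csqrt s\<close>, a common factor cancels
  and the chordal quotient of \<open>n_fun\<close> and \<open>d_fun\<close> takes the following closed form.  Note the factor
  \<open>\<bar>sinh w\<bar>\<close> in the numerator, and that no \<open>sinh (a w)\<close> occurs in the denominator.\<close>

lemma chordal_quotient_n_fun_d_fun:
  assumes s: "Re s \<ge> 0" "s \<noteq> 0" and a: "0 < a" "a < 1" and b: "0 < b" "b < 1"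
  defines "w \<equiv> csqrt s"
  shows "chordal_quotient (n_fun a s) (d_fun a s) (n_fun b s) (d_fun b s) =
    norm w * norm (sinh w) * norm (cosh (of_real a * w) - cosh (of_real b * w)) /
      (sqrt ((norm (cosh (of_real a * w)))\<^sup>2 + norm s * (norm (sinh w))\<^sup>2) *
       sqrt ((norm (cosh (of_real b * w)))\<^sup>2 + norm s * (norm (sinh w))\<^sup>2))"
proof -
  have sq: "w\<^sup>2 = s" by (simp add: w_def)
  have re: "(Re w)\<^sup>2 - (Im w)\<^sup>2 \<ge> 0" using s(1) arg_cong[OF sq, of Re] unfolding Re_power2 by simp
  have w0: "w \<noteq> 0" using s by (simp add: w_def)
  have nn: "Re w \<ge> 0" unfolding w_def by (rule Re_csqrt)
  have im: "\<bar>Im w\<bar> \<le> Re w" using re nn abs_le_square_iff[of "Im w" "Re w"] by simp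
  then have pos: "Re w > 0" using w0 nn by (auto simp: complex_eq_iff less_eq_real_def)
  have w1: "w + 1 \<noteq> 0" using pos by (auto simp: complex_eq_iff)
  have sh: "sinh (of_real t * w) \<noteq> 0" if "0 < t" for t :: real
  proof -
    have "(sinh (t * Re w))\<^sup>2 > 0" using pos that by (intro zero_less_power) simp
    then have "(norm (sinh (of_real t * w)))\<^sup>2 > 0" unfolding norm_sinh_squared
      by (intro add_pos_nonneg) (simp_all del: zero_less_power2)
    then show ?thesis by auto
  qed
  define c where "c t = sinh (of_real t * w) / ((w + 1) * sinh w * cosh (of_real t * w))" for t :: real
  have c: "n_fun t s = c t * cosh (of_real t * w)" "d_fun t s = c t * (w * sinh w)" "c t \<noteq> 0"
    if "0 < t" "t < 1" for t
    using sector_bounds(1,2)[OF pos im that] sh[OF that(1)] w1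
    unfolding n_fun_def d_fun_def c_def w_def[symmetric] by simp_all
  have "norm s = (norm w)\<^sup>2" using sq by (metis norm_power)
  moreover have "norm (cosh (of_real a * w) * (w * sinh w) - cosh (of_real b * w) * (w * sinh w)) =
      norm w * norm (sinh w) * norm (cosh (of_real a * w) - cosh (of_real b * w))"
    by (simp flip: norm_mult add: algebra_simps)
  ultimately show ?thesis
    unfolding c(1,2)[OF a] c(1,2)[OF b] chordal_quotient_scale[OF c(3)[OF a] c(3)[OF b]]
    by (simp add: chordal_quotient_def norm_mult power_mult_distrib)
qed

definition plant :: "real \<Rightarrow> hinf fract" where
  "plant a = Fract (to_disc (n_fun a)) (to_disc (d_fun a))"

definition boundary_value :: "(complex \<Rightarrow> complex) \<Rightarrow> real \<Rightarrow> complex" where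
  "boundary_value f y =
     (if y = 0 then Lim (at 0) (\<lambda>t::real. f (\<i> * of_real t)) else f (\<i> * of_real y))"

end

theory Submission
  imports Defs
begin

text \<open>Transported to the disc, \<open>n_a\<close> and \<open>d_a\<close> extend continuously to the closed disc, jointly in
  the point and in \<open>a\<close>; the point \<open>1\<close>, which is \<open>s = \<infinity>\<close>, gets the values \<open>0\<close> and \<open>1\<close>.  They have no
  common zero, so by compactness of the circle the pairing with \<open>n_b, d_b\<close> has positive real part on
  the circle for \<open>b\<close> near \<open>a\<close>; it is then invertible near the circle and homotopic to a constant.
  Tuples of functions that are continuous on the closed disc take under the characters of the limit
  algebra exactly their values at the points of the circle: evaluation at a boundary point is extended to
  the whole algebra by an ultrafilter limit along a radius.  Hence the chordal distance is a supremum over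
  the circle, where \<open>s = \<infinity>\<close> and \<open>s = 0\<close> contribute \<open>0\<close> and conjugation identifies \<open>y\<close> with \<open>- y\<close>.
  Another coprime factorisation differs by a unit, whose winding number vanishes because the unit has
  no zero in the disc.\<close>

section \<open>Ultrafilter limits\<close>

text \<open>Zorn's lemma gives a minimal proper filter below \<open>F\<close>, and minimality makes
  it decide every predicate.\<close>

lemma ultrafilter_below:
  fixes F :: "'a filter"
  assumes "F \<noteq> bot"
  obtains U where "U \<noteq> bot" "U \<le> F" "\<And>P. eventually P U \<or> eventually (\<lambda>x. \<not> P x) U"
proof -
  define A where "A = {U. U \<noteq> bot \<and> U \<le> F}"
  have "\<exists>U\<in>A. \<forall>V\<in>A. U \<ge> V \<longrightarrow> V = U"
  proof (rule predicate_Zorn)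
    show "partial_order_on A (relation_of (\<ge>) A)"
      by (rule partial_order_on_relation_ofI) auto
  next
    fix C assume "C \<in> Chains (relation_of (\<ge>) A)"
    then have C: "C \<subseteq> A" "\<And>U V. U \<in> C \<Longrightarrow> V \<in> C \<Longrightarrow> U \<le> V \<or> V \<le> U"
      by (auto simp: Chains_def relation_of_def)
    show "\<exists>U\<in>A. \<forall>V\<in>C. V \<ge> U"
    proof (cases "C = {}")
      case True
      with assms show ?thesis by (auto simp: A_def)
    next
      case False
      \<comment> \<open>A chain is directed, so whatever holds eventually for its infimum already
        does so for one member; hence the infimum is proper.\<close>
      have "eventually P (Inf C) \<longleftrightarrow> (\<exists>U\<in>C. eventually P U)" for P
        by (rule eventually_Inf_base[OF False]) (metis C(2) inf.absorb1 inf.absorb2 order_refl)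
      moreover have "\<not> eventually (\<lambda>_. False) U" if "U \<in> C" for U
        using that C(1) by (auto simp: A_def eventually_False)
      ultimately have "Inf C \<noteq> bot" by (metis eventually_bot)
      moreover have "Inf C \<le> F"
        using False C(1) by (auto simp: A_def intro: Inf_lower2)
      ultimately show ?thesis by (auto simp: A_def intro!: bexI[of _ "Inf C"] Inf_lower)
    qed
  qed
  then obtain U where U: "U \<in> A" "\<And>V. V \<in> A \<Longrightarrow> V \<le> U \<Longrightarrow> V = U" by blast
  \<comment> \<open>Restricting \<open>U\<close> to \<open>P\<close> either gives the improper
    filter, so that the negation holds eventually, or by minimality gives \<open>U\<close>
    back.\<close>
  have "eventually P U \<or> eventually (\<lambda>x. \<not> P x) U" for P
  proof (cases "inf U (principal {x. P x}) = bot")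
    case True
    then show ?thesis by (simp add: trivial_limit_def eventually_inf_principal)
  next
    case False
    have "inf U (principal {x. P x}) \<le> F" using U(1) by (auto simp: A_def intro: le_infI1)
    with False have "inf U (principal {x. P x}) = U" by (intro U(2)) (auto simp: A_def)
    then have "eventually P (inf U (principal {x. P x})) \<longleftrightarrow> eventually P U" by simp
    then show ?thesis by (simp add: eventually_inf_principal)
  qed
  with U(1) that show ?thesis by (auto simp: A_def)
qed

text \<open>Compactness yields a cluster point of \<open>f\<close> along \<open>U\<close>. An
  ultrafilter decides whether \<open>f\<close> stays in a given neighbourhood, so it converges to
  every cluster point.\<close>

lemma ultrafilter_tendsto_compact:
  assumes "U \<noteq> bot" and ultra: "\<And>P. eventually P U \<or> eventually (\<lambda>x. \<not> P x) U"
    and "compact K" and "\<forall>\<^sub>F x in U. f x \<in> K"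
  obtains l where "(f \<longlongrightarrow> l) U"
proof -
  have "filtermap f U \<noteq> bot" using assms(1) by (simp add: filtermap_bot_iff)
  moreover have "eventually (\<lambda>y. y \<in> K) (filtermap f U)"
    using assms(4) by (simp add: eventually_filtermap)
  ultimately obtain l where l: "inf (nhds l) (filtermap f U) \<noteq> bot"
    using assms(3) unfolding compact_filter by blast
  have "(f \<longlongrightarrow> l) U"
  proof (rule topological_tendstoI)
    fix S assume S: "open S" "l \<in> S"
    show "\<forall>\<^sub>F x in U. f x \<in> S"
    proof (rule ccontr)
      assume "\<not> (\<forall>\<^sub>F x in U. f x \<in> S)"
      with ultra[of "\<lambda>x. f x \<in> S"] have "\<forall>\<^sub>F x in U. f x \<notin> S" by simp
      moreover have "eventually (\<lambda>y. y \<in> S) (nhds l)" using S by (rule eventually_nhds_in_open)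
      ultimately have "eventually (\<lambda>_. False) (inf (nhds l) (filtermap f U))"
        unfolding eventually_inf eventually_filtermap
        by (intro exI[of _ "\<lambda>y. y \<in> S"] exI[of _ "\<lambda>y. y \<notin> S"]) auto
      with l show False by (simp add: trivial_limit_def)
    qed
  qed
  with that show ?thesis .
qed

section \<open>Classes of functions on the disc\<close>

text \<open>Unlike \<open>hinf\<close>, this class is closed under conjugation, so it contains the
  pairing and the functions built from squared moduli.\<close>

definition disc_Cb :: "(complex \<Rightarrow> complex) set" where
  "disc_Cb = {f. continuous_on (ball 0 1) f \<and> bounded (f ` ball 0 1)}"

definition limalg_class :: "(complex \<Rightarrow> complex) \<Rightarrow> limalg" where
  "limalg_class f = abs_limalg (\<lambda>_. f)"

lemma disc_Cb_family: "f \<in> disc_Cb \<Longrightarrow> (\<lambda>_. f) \<in> family"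
proof -
  assume f: "f \<in> disc_Cb"
  have "annulus r \<subseteq> ball 0 1" for r by (auto simp: annulus_def)
  then have "f \<in> Cb r" for r
    using f unfolding Cb_def disc_Cb_def mem_Collect_eq
    by (metis continuous_on_subset bounded_subset image_mono)
  moreover have "(1/2::real) \<in> {0<..<1}" by simp
  ultimately show "(\<lambda>_. f) \<in> family" unfolding family_def by blast
qed

lemma disc_Cb_limrel: "f \<in> disc_Cb \<Longrightarrow> limrel (\<lambda>_. f) (\<lambda>_. f)"
  by (intro limrel_refl disc_Cb_family)

lemma disc_Cb_add: "f \<in> disc_Cb \<Longrightarrow> g \<in> disc_Cb \<Longrightarrow> (\<lambda>z. f z + g z) \<in> disc_Cb"
  by (auto simp: disc_Cb_def intro!: continuous_intros bounded_plus_comp)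

lemma disc_Cb_mult: "f \<in> disc_Cb \<Longrightarrow> g \<in> disc_Cb \<Longrightarrow> (\<lambda>z. f z * g z) \<in> disc_Cb"
  by (auto simp: disc_Cb_def intro!: continuous_intros bounded_image_times)

lemma disc_Cb_cnj: "f \<in> disc_Cb \<Longrightarrow> (\<lambda>z. cnj (f z)) \<in> disc_Cb"
  by (auto simp: disc_Cb_def bounded_image_iff intro!: continuous_intros)

lemma disc_Cb_const: "(\<lambda>_. c) \<in> disc_Cb"
  by (auto simp: disc_Cb_def bounded_image_iff)

lemma continuous_cball_disc_Cb:
  assumes "continuous_on (cball 0 1) f" shows "f \<in> disc_Cb"
proof -
  have "bounded (f ` cball 0 1)"
    using assms by (intro compact_imp_bounded compact_continuous_image compact_cball)
  moreover have "f ` ball 0 1 \<subseteq> f ` cball 0 1" by auto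
  ultimately have "bounded (f ` ball 0 1)" by (rule bounded_subset)
  moreover have "continuous_on (ball 0 1) f"
    using assms by (rule continuous_on_subset) auto
  ultimately show ?thesis by (simp add: disc_Cb_def)
qed

lemma hinf_fun_holomorphic: "hinf_fun h holomorphic_on ball 0 1"
  and hinf_fun_bounded: "bounded (hinf_fun h ` ball 0 1)"
  using hinf_fun[of h] by auto

lemma hinf_fun_disc_Cb: "hinf_fun h \<in> disc_Cb"
  by (simp add: disc_Cb_def hinf_fun_bounded holomorphic_on_imp_continuous_on hinf_fun_holomorphic)

lemma limalg_of_hinf_eq_class: "limalg_of_hinf h = limalg_class (hinf_fun h)"
  by (simp add: limalg_of_hinf_def limalg_class_def)

lemma limalg_class_add:
  "f \<in> disc_Cb \<Longrightarrow> g \<in> disc_Cb \<Longrightarrow> limalg_class f + limalg_class g = limalg_class (\<lambda>z. f z + g z)"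
  unfolding limalg_class_def by (rule plus_limalg.abs_eq) (rule disc_Cb_limrel, assumption)+

lemma limalg_class_mult:
  "f \<in> disc_Cb \<Longrightarrow> g \<in> disc_Cb \<Longrightarrow> limalg_class f * limalg_class g = limalg_class (\<lambda>z. f z * g z)"
  unfolding limalg_class_def by (rule times_limalg.abs_eq) (rule disc_Cb_limrel, assumption)+

lemma limalg_class_cnj:
  "f \<in> disc_Cb \<Longrightarrow> star_limalg (limalg_class f) = limalg_class (\<lambda>z. cnj (f z))"
  unfolding limalg_class_def by (rule star_limalg.abs_eq) (rule disc_Cb_limrel)

lemma limalg_class_scale:
  "f \<in> disc_Cb \<Longrightarrow> scale_limalg c (limalg_class f) = limalg_class (\<lambda>z. c * f z)"
  unfolding limalg_class_def by (rule scale_limalg.abs_eq) (rule disc_Cb_limrel)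

lemma limalg_class_1: "limalg_class (\<lambda>_. 1) = 1"
  by (simp add: limalg_class_def one_limalg_def)

text \<open>The seminorm is a limit over ever thinner annuli, so only the values near the circle
  matter.\<close>

lemma limalg_class_eqI:
  assumes "f \<in> disc_Cb" "g \<in> disc_Cb" "r0 < 1"
    and eq: "\<And>z. r0 < norm z \<Longrightarrow> norm z < 1 \<Longrightarrow> f z = g z"
  shows "limalg_class f = limalg_class g"
proof -
  have "family_seminorm (\<lambda>r z. f z - g z) = 0"
  proof (rule tendsto_imp_family_seminorm, rule Lim_transform_eventually[OF tendsto_const])
    have "\<forall>\<^sub>F r in at_left 1. r \<in> {r0<..<1}"
      using assms by (intro eventually_at_left_real) auto
    then show "\<forall>\<^sub>F r in at_left 1. 0 = supnorm r (\<lambda>z. f z - g z)"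
    proof eventually_elim
      case (elim r)
      have "supnorm r (\<lambda>z. f z - g z) = (SUP z\<in>annulus r. 0)"
        unfolding supnorm_def using elim by (intro SUP_cong) (auto simp: annulus_def eq)
      with elim show ?case by (simp add: annulus_nonempty)
    qed
  qed
  then have "limrel (\<lambda>_. f) (\<lambda>_. g)"
    using assms by (simp add: limrel_def disc_Cb_family)
  then show ?thesis
    unfolding limalg_class_def by (simp add: Quotient_rel_abs[OF Quotient_limalg])
qed

lemma limalg_class_invertible:
  assumes f: "f \<in> disc_Cb" and "r0 < 1" "0 < \<delta>"
    and low: "\<And>z. r0 < norm z \<Longrightarrow> norm z < 1 \<Longrightarrow> \<delta> \<le> norm (f z)"
  shows "limalg_class f dvd 1"
proof -
  \<comment> \<open>Near the circle this is \<open>1 / f\<close>. The cut-off at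
    \<open>\<delta>\<^sup>2\<close> keeps it continuous and bounded on the rest of the disc, where
    \<open>f\<close> may vanish.\<close>
  define g where "g z = cnj (f z) / of_real (max (\<delta>\<^sup>2) ((norm (f z))\<^sup>2))" for z
  have cont: "continuous_on (ball 0 1) f" using f by (simp add: disc_Cb_def)
  have pos: "max (\<delta>\<^sup>2) ((norm (f z))\<^sup>2) > 0" for z using \<open>0 < \<delta>\<close> by (auto simp: less_max_iff_disj)
  then have nz: "complex_of_real (max (\<delta>\<^sup>2) ((norm (f z))\<^sup>2)) \<noteq> 0" for z
    by (metis less_irrefl of_real_eq_0_iff)
  obtain B where B: "\<And>z. z \<in> ball 0 1 \<Longrightarrow> norm (f z) \<le> B"
    using f unfolding disc_Cb_def bounded_image_iff by blast
  have "norm (g z) \<le> B / \<delta>\<^sup>2" if "z \<in> ball 0 1" for z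
  proof -
    have "norm (g z) = norm (f z) / max (\<delta>\<^sup>2) ((norm (f z))\<^sup>2)"
      using pos[of z] by (simp add: g_def norm_divide)
    also have "\<dots> \<le> B / \<delta>\<^sup>2"
      using B[OF that] pos \<open>0 < \<delta>\<close> by (intro frac_le) (auto intro: order_trans[OF norm_ge_zero])
    finally show ?thesis .
  qed
  moreover have "continuous_on (ball 0 1) g"
    unfolding g_def using nz by (intro continuous_intros cont) auto
  ultimately have g: "g \<in> disc_Cb" unfolding disc_Cb_def bounded_image_iff by blast
  have "f z * g z = 1" if "r0 < norm z" "norm z < 1" for z
  proof -
    have "\<delta>\<^sup>2 \<le> (norm (f z))\<^sup>2" using low[OF that] \<open>0 < \<delta>\<close> by (intro power_mono) auto
    then have m: "max (\<delta>\<^sup>2) ((norm (f z))\<^sup>2) = (norm (f z))\<^sup>2" by simp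
    have "f z \<noteq> 0" using low[OF that] \<open>0 < \<delta>\<close> by auto
    then show ?thesis unfolding g_def m complex_norm_square by simp
  qed
  then have "limalg_class (\<lambda>z. f z * g z) = limalg_class (\<lambda>_. 1)"
    using \<open>r0 < 1\<close> by (intro limalg_class_eqI[of _ _ r0] disc_Cb_mult disc_Cb_const f g) auto
  then have "1 = limalg_class f * limalg_class g"
    by (simp add: limalg_class_mult f g limalg_class_1)
  then show ?thesis by (rule dvdI)
qed

text \<open>The zeros in the closed disc form a compact set that misses the circle, so they lie in a
  smaller disc; on the remaining closed annulus the norm attains a positive minimum.\<close>

lemma nonzero_on_circle_imp_bounded_below:
  fixes f :: "complex \<Rightarrow> 'a::real_normed_vector"
  assumes cont: "continuous_on (cball 0 1) f" and nz: "\<forall>z\<in>sphere 0 1. f z \<noteq> 0"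
  obtains r0 \<delta> where "0 < r0" "r0 < 1" "0 < \<delta>"
    "\<And>z. r0 < norm z \<Longrightarrow> norm z \<le> 1 \<Longrightarrow> \<delta> \<le> norm (f z)"
proof -
  define K where "K = {z \<in> cball 0 1. f z = 0}"
  have "closed K" unfolding K_def
    using continuous_closed_preimage_constant[OF cont, of 0] by simp
  moreover have "bounded K" by (rule bounded_subset[OF bounded_cball[of 0 1]]) (auto simp: K_def)
  ultimately have "compact K" by (simp add: compact_eq_bounded_closed)
  obtain r1 where r1: "0 \<le> r1" "r1 < 1" "\<And>z. z \<in> K \<Longrightarrow> norm z \<le> r1"
  proof (cases "K = {}")
    case False
    then obtain x where "x \<in> K" "\<And>z. z \<in> K \<Longrightarrow> norm z \<le> norm x"
      using continuous_attains_sup[OF \<open>compact K\<close> False, of norm] by (auto intro: continuous_intros)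
    moreover have "norm x < 1" using \<open>x \<in> K\<close> nz by (auto simp: K_def less_le)
    ultimately show ?thesis using that[of "norm x"] by auto
  qed (use that[of 0] in auto)
  \<comment> \<open>Strictly between \<open>r1\<close> and 1, so that the closed annulus
    \<open>L\<close> contains no zero.\<close>
  define r0 where "r0 = (r1 + 1) / 2"
  define L where "L = cball 0 1 - ball (0::complex) r0"
  have r0: "0 < r0" "r1 < r0" "r0 < 1" using r1 by (auto simp: r0_def)
  have "compact L" unfolding L_def by (intro compact_diff) auto
  moreover have "(1::complex) \<in> L" using r0 by (auto simp: L_def)
  moreover have "continuous_on L (\<lambda>z. norm (f z))"
    by (intro continuous_intros continuous_on_subset[OF cont]) (auto simp: L_def)
  ultimately obtain x where x: "x \<in> L" "\<And>z. z \<in> L \<Longrightarrow> norm (f x) \<le> norm (f z)"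
    using continuous_attains_inf[of L "\<lambda>z. norm (f z)"] by blast
  have "f x \<noteq> 0" using x(1) r1(3)[of x] r0 by (auto simp: L_def K_def)
  then show ?thesis using that[of r0 "norm (f x)"] r0 x(2) by (auto simp: L_def)
qed

section \<open>Characters and boundary points\<close>

lemma max_ideal_spaceD:
  assumes "\<phi> \<in> max_ideal_space"
  shows "\<phi> (F + G) = \<phi> F + \<phi> G" "\<phi> (F * G) = \<phi> F * \<phi> G" "\<phi> (scale_limalg c F) = c * \<phi> F"
    "\<phi> 1 = 1" "F dvd 1 \<Longrightarrow> \<phi> F \<noteq> 0"
proof -
  show mult: "\<phi> (F * G) = \<phi> F * \<phi> G" for F G using assms by (simp add: max_ideal_space_def)
  show "\<phi> (F + G) = \<phi> F + \<phi> G" "\<phi> (scale_limalg c F) = c * \<phi> F"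
    using assms by (auto simp: max_ideal_space_def)
  obtain H where "\<phi> H \<noteq> 0" using assms by (auto simp: max_ideal_space_def fun_eq_iff)
  with mult[of 1 H] show one: "\<phi> 1 = 1" by simp
  assume "F dvd 1"
  then obtain G where "1 = F * G" by (rule dvdE)
  with one mult[of F G] show "\<phi> F \<noteq> 0" by auto
qed

text \<open>The values \<open>\<phi> f\<close>, \<open>f \<in> \<F>\<close>, of a character are attained simultaneously at a boundary point:
  the function \<open>\<Sum>\<bar>f - \<phi> f\<bar>\<^sup>2\<close> lies in the kernel of \<open>\<phi>\<close>, so it cannot be bounded below near the circle.\<close>

lemma max_ideal_space_boundary_point:
  assumes \<phi>: "\<phi> \<in> max_ideal_space" and "finite \<F>"
    and "\<forall>f\<in>\<F>. continuous_on (cball 0 1) f"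
  obtains z where "norm z = 1" "\<forall>f\<in>\<F>. \<phi> (limalg_class f) = f z"
proof -
  note \<phi>' = max_ideal_spaceD[OF \<phi>] and cont = bspec[OF assms(3)]
  have one: "\<phi> (limalg_class (\<lambda>_. c)) = c" for c
    using \<phi>'(3)[of c 1] limalg_class_scale[OF disc_Cb_const, of c 1] by (simp add: limalg_class_1 \<phi>'(4))
  define c where "c f = \<phi> (limalg_class f)" for f
  define g where "g f z = cnj (f z - c f) * (f z - c f)" for f z
  have gcont: "continuous_on (cball 0 1) (g f)" if "f \<in> \<F>" for f
    unfolding g_def by (intro continuous_intros cont that)
  have g0: "\<phi> (limalg_class (g f)) = 0" if "f \<in> \<F>" for f
  proof -
    have f: "f \<in> disc_Cb" using cont[OF that] by (rule continuous_cball_disc_Cb)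
    define h where "h z = f z + (- c f)" for z
    have h: "h \<in> disc_Cb" unfolding h_def by (intro disc_Cb_add f disc_Cb_const)
    have "\<phi> (limalg_class h) = 0"
      unfolding h_def limalg_class_add[OF f disc_Cb_const, symmetric] \<phi>'(1) one by (simp add: c_def)
    then have "\<phi> (limalg_class (\<lambda>z. cnj (h z) * h z)) = 0"
      \<comment> \<open>The factor \<open>h\<close> alone is killed by \<open>\<phi>\<close>, so the
        product is too, whatever value \<open>\<phi>\<close> gives to the conjugate.\<close>
      by (simp add: limalg_class_mult[OF disc_Cb_cnj[OF h] h, symmetric] \<phi>'(2))
    then show ?thesis by (simp add: g_def[abs_def] h_def)
  qed
  have sum0: "\<phi> (limalg_class (\<lambda>z. \<Sum>f\<in>\<G>. g f z)) = 0 \<and> continuous_on (cball 0 1) (\<lambda>z. \<Sum>f\<in>\<G>. g f z)"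
    if "finite \<G>" "\<G> \<subseteq> \<F>" for \<G>
    using that
  proof (induction rule: finite_induct)
    case (insert f \<G>)
    then have "g f \<in> disc_Cb" "(\<lambda>z. \<Sum>f\<in>\<G>. g f z) \<in> disc_Cb"
      by (auto intro!: continuous_cball_disc_Cb gcont)
    with insert show ?case
      by (simp add: limalg_class_add[symmetric] \<phi>'(1) g0) (auto intro!: continuous_intros gcont)
  qed (auto simp: one)
  have "\<exists>z. norm z = 1 \<and> (\<Sum>f\<in>\<F>. g f z) = 0"
  proof (rule ccontr)
    assume "\<not> ?thesis"
    then have nz: "\<forall>z\<in>sphere 0 1. (\<Sum>f\<in>\<F>. g f z) \<noteq> 0" by auto
    have "continuous_on (cball 0 1) (\<lambda>z. \<Sum>f\<in>\<F>. g f z)" using sum0[OF \<open>finite \<F>\<close>] by simp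
    from nonzero_on_circle_imp_bounded_below[OF this nz]
    obtain r0 \<delta> where "0 < r0" "r0 < 1" "0 < \<delta>"
      "\<And>z. r0 < norm z \<Longrightarrow> norm z \<le> 1 \<Longrightarrow> \<delta> \<le> norm (\<Sum>f\<in>\<F>. g f z)" by blast
    then have "limalg_class (\<lambda>z. \<Sum>f\<in>\<F>. g f z) dvd 1"
      using sum0[OF \<open>finite \<F>\<close>]
      by (intro limalg_class_invertible[of _ r0 \<delta>] continuous_cball_disc_Cb) auto
    with \<phi>'(5) sum0[OF \<open>finite \<F>\<close>] show False by auto
  qed
  then obtain z where z: "norm z = 1" "(\<Sum>f\<in>\<F>. g f z) = 0" by blast
  \<comment> \<open>All summands are real and nonnegative, so the vanishing of the sum forces each
    of them to vanish.\<close>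
  have "g f z = of_real ((norm (f z - c f))\<^sup>2)" for f
    unfolding g_def by (simp only: complex_norm_square mult.commute)
  with z(2) have "of_real (\<Sum>f\<in>\<F>. (norm (f z - c f))\<^sup>2) = (0::complex)" by simp
  then have "(\<Sum>f\<in>\<F>. (norm (f z - c f))\<^sup>2) = 0" by (simp only: of_real_eq_0_iff)
  then have "\<phi> (limalg_class f) = f z" if "f \<in> \<F>" for f
    using that \<open>finite \<F>\<close> by (simp add: sum_nonneg_eq_0_iff c_def)
  with z(1) that show ?thesis by blast
qed

text \<open>This makes limits along points \<open>p r\<close> independent of the representative of a
  class.\<close>

lemma limrel_tendsto_diff:
  assumes "limrel f g" and "\<And>r. r \<in> {0<..<1} \<Longrightarrow> p r \<in> annulus r"
  shows "((\<lambda>r. f r (p r) - g r (p r)) \<longlongrightarrow> 0) (at_left 1)"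
proof -
  have fam: "(\<lambda>r z. f r z - g r z) \<in> family" using assms by (auto simp: limrel_def intro: family_diff)
  have "((\<lambda>r. supnorm r (\<lambda>z. f r z - g r z)) \<longlongrightarrow> 0) (at_left 1)"
    using tendsto_family_seminorm[OF fam] assms(1) by (simp add: limrel_def)
  moreover have "\<forall>\<^sub>F r in at_left 1. r \<in> {0<..<1::real}"
    by (rule eventually_at_left_real) simp
  then have "\<forall>\<^sub>F r in at_left 1. norm (f r (p r) - g r (p r)) \<le> supnorm r (\<lambda>z. f r z - g r z)"
  proof eventually_elim
    case (elim r)
    then show ?case
      using fam assms(2) by (intro Cb_le_supnorm) (auto simp: family_def)
  qed
  ultimately show ?thesis by (rule Lim_null_comparison[rotated])
qed

lemma boundary_point_character:
  assumes "norm z0 = 1"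
  obtains \<phi> where "\<phi> \<in> max_ideal_space"
    "\<And>f. continuous_on (cball 0 1) f \<Longrightarrow> \<phi> (limalg_class f) = f z0"
proof -
  obtain U where U: "U \<noteq> bot" "U \<le> at_left (1::real)" "\<And>P. eventually P U \<or> eventually (\<lambda>x. \<not> P x) U"
    using ultrafilter_below[of "at_left (1::real)"] by (auto simp: trivial_limit_at_left_real)
  \<comment> \<open>The radius halfway between \<open>r\<close> and 1 puts \<open>p r\<close> inside
    \<open>annulus r\<close>, where the member with index \<open>r\<close> is controlled, and still
    tends to 1.\<close>
  define p where "p r = of_real ((1 + r) / 2) * z0" for r :: real
  have np: "norm (p r) = (1 + r) / 2" if "r \<in> {0<..<1}" for r
    using that assms unfolding p_def norm_mult norm_of_real by simp
  have p: "p r \<in> annulus r" if "r \<in> {0<..<1}" for r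
    unfolding annulus_def mem_Collect_eq np[OF that] using that by auto
  have evU: "\<forall>\<^sub>F r in U. r \<in> {a<..<1}" if "a < 1" for a
    using filter_leD[OF U(2) eventually_at_left_real[OF that]] .
  define \<phi> where "\<phi> F = Lim U (\<lambda>r. rep_limalg F r (p r))" for F
  have rep: "limrel (rep_limalg F) (rep_limalg F)" for F
    by (rule Quotient_rep_reflp[OF Quotient_limalg])
  \<comment> \<open>Representatives are bounded near the circle, so the ultrafilter limit exists and
    \<open>Lim\<close> denotes it.\<close>
  have \<phi>: "((\<lambda>r. rep_limalg F r (p r)) \<longlongrightarrow> \<phi> F) U" for F
  proof -
    obtain r0 B where B: "r0 \<in> {0<..<1}"
      "\<And>r z. r0 \<le> r \<Longrightarrow> r < 1 \<Longrightarrow> z \<in> annulus r \<Longrightarrow> norm (rep_limalg F r z) \<le> B"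
      using family_bounded[OF limrel_memD(1)[OF rep[of F]]] by metis
    have "\<forall>\<^sub>F r in U. rep_limalg F r (p r) \<in> cball 0 B"
      using evU[of r0] B(1) by (auto intro!: B(2) p elim!: eventually_mono)
    from ultrafilter_tendsto_compact[OF U(1,3) compact_cball this]
    obtain l where l: "((\<lambda>r. rep_limalg F r (p r)) \<longlongrightarrow> l) U" .
    then show ?thesis unfolding \<phi>_def by (simp add: tendsto_Lim[OF U(1) l])
  qed
  \<comment> \<open>Any representative may replace the chosen one; the algebraic laws of
    \<open>\<phi>\<close> then reduce to those of limits.\<close>
  have \<phi>_abs: "\<phi> (abs_limalg f) = l" if "f \<in> family" "((\<lambda>r. f r (p r)) \<longlongrightarrow> l) U" for f l
  proof -
    have "limrel (rep_limalg (abs_limalg f)) f"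
      using that by (intro Quotient_rep_abs[OF Quotient_limalg] limrel_refl)
    then have "((\<lambda>r. rep_limalg (abs_limalg f) r (p r) - f r (p r)) \<longlongrightarrow> 0) U"
      by (intro filterlim_mono[OF limrel_tendsto_diff _ U(2)] p) auto
    from tendsto_add[OF this that(2)] have "((\<lambda>r. rep_limalg (abs_limalg f) r (p r)) \<longlongrightarrow> l) U" by simp
    with \<phi> show ?thesis by (rule tendsto_unique[OF U(1)])
  qed
  have abs_rep: "abs_limalg (rep_limalg F) = F" for F by (rule Quotient_abs_rep[OF Quotient_limalg])
  note fam = limrel_memD(1)[OF rep]
  have "\<phi> \<in> max_ideal_space"
    unfolding max_ideal_space_def
  proof (safe)
    fix F G c
    have "F + G = abs_limalg (\<lambda>r z. rep_limalg F r z + rep_limalg G r z)"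
      by (metis abs_rep plus_limalg.abs_eq rep)
    then show "\<phi> (F + G) = \<phi> F + \<phi> G"
      by (simp add: \<phi>_abs family_add fam tendsto_add[OF \<phi> \<phi>])
    have "F * G = abs_limalg (\<lambda>r z. rep_limalg F r z * rep_limalg G r z)"
      by (metis abs_rep times_limalg.abs_eq rep)
    then show "\<phi> (F * G) = \<phi> F * \<phi> G"
      by (simp add: \<phi>_abs family_mult fam tendsto_mult[OF \<phi> \<phi>])
    have "scale_limalg c F = abs_limalg (\<lambda>r z. c * rep_limalg F r z)"
      by (metis abs_rep scale_limalg.abs_eq rep)
    then show "\<phi> (scale_limalg c F) = c * \<phi> F"
      by (simp add: \<phi>_abs family_mult family_const fam tendsto_mult[OF tendsto_const \<phi>])
  next
    assume "\<phi> = (\<lambda>_. 0)"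
    moreover have "\<phi> (abs_limalg (\<lambda>_ _. 1)) = 1" by (intro \<phi>_abs family_const tendsto_const)
    ultimately show False by simp
  qed
  moreover have "\<phi> (limalg_class f) = f z0" if "continuous_on (cball 0 1) f" for f
    unfolding limalg_class_def
  proof (rule \<phi>_abs)
    show "(\<lambda>_. f) \<in> family" by (intro disc_Cb_family continuous_cball_disc_Cb that)
    have "((\<lambda>r. (1 + r) / 2) \<longlongrightarrow> (1 + 1) / 2) (at_left (1::real))" by (intro tendsto_intros) auto
    then have "(p \<longlongrightarrow> of_real 1 * z0) (at_left 1)"
      unfolding p_def by (intro tendsto_intros) auto
    then have "(p \<longlongrightarrow> z0) U" using U(2) by (simp add: filterlim_mono)
    moreover have "\<forall>\<^sub>F r in U. p r \<in> cball 0 1"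
      using evU[of 0] by (auto elim!: eventually_mono simp: np)
    ultimately show "((\<lambda>r. f (p r)) \<longlongrightarrow> f z0) U"
      using assms by (intro continuous_on_tendsto_compose[OF that]) auto
  qed
  ultimately show ?thesis using that by blast
qed


section \<open>The index of classes with trivial winding\<close>

text \<open>\<open>index\<close> looks at an arbitrary representative. Close to the circle this
  differs from \<open>p\<close> by less than \<open>\<delta>\<close>, hence by less than the
  distance of \<open>p\<close> from 0, so both have the same winding number.\<close>

lemma index_limalg_class_eq_0:
  assumes p: "p \<in> disc_Cb" and "r0 < 1" "0 < \<delta>"
    and low: "\<And>z. r0 < norm z \<Longrightarrow> norm z < 1 \<Longrightarrow> \<delta> \<le> norm (p z)"
    and wind: "\<And>r. 0 < r \<Longrightarrow> r0 < r \<Longrightarrow> r < 1 \<Longrightarrow> winding_number (p \<circ> circlepath 0 r) 0 = 0"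
  shows "index (limalg_class p) = 0"
proof -
  define g where "g = rep_limalg (limalg_class p)"
  have g: "limrel g (\<lambda>_. p)"
    unfolding g_def limalg_class_def by (rule Quotient_rep_abs[OF Quotient_limalg, OF disc_Cb_limrel[OF p]])
  then have "g \<in> family" by (rule limrel_memD)
  have fam: "(\<lambda>r z. g r z - p z) \<in> family" using g by (auto simp: limrel_def intro: family_diff)
  have "((\<lambda>r. supnorm r (\<lambda>z. g r z - p z)) \<longlongrightarrow> 0) (at_left 1)"
    using tendsto_family_seminorm[OF fam] g by (simp add: limrel_def)
  then have "\<forall>\<^sub>F r in at_left 1. supnorm r (\<lambda>z. g r z - p z) < \<delta>"
    using \<open>0 < \<delta>\<close> by (rule order_tendstoD)
  \<comment> \<open>\<open>r0\<close> may be negative, whereas a family is only constrained at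
    indices in (0,1).\<close>
  moreover have "\<forall>\<^sub>F r in at_left 1. r \<in> {max 0 r0<..<1}"
    using \<open>r0 < 1\<close> by (intro eventually_at_left_real) auto
  ultimately have "\<forall>\<^sub>F r in at_left 1. annulus_winding r (g r) = 0"
  proof eventually_elim
    case (elim r)
    have cont: "continuous_on (annulus r) (g r)"
      using elim \<open>g \<in> family\<close> by (auto simp: family_def Cb_def)
    have "winding_number (g r \<circ> circlepath 0 \<rho>) 0 = 0" if \<rho>: "\<rho> \<in> {r<..<1}" for \<rho>
    proof -
      have circ: "circlepath 0 \<rho> t \<in> annulus r" for t
        using \<rho> elim by (auto simp: annulus_def circlepath norm_mult)
      then have img: "path_image (circlepath 0 \<rho>) \<subseteq> annulus r" by (auto simp: path_image_def)
      have "winding_number (g r \<circ> circlepath 0 \<rho>) 0 = winding_number (p \<circ> circlepath 0 \<rho>) 0"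
      proof (rule winding_number_nearby_loops_eq)
        show "path (g r \<circ> circlepath 0 \<rho>)"
          by (intro path_continuous_image continuous_on_subset[OF cont img]) simp
        have "continuous_on (annulus r) p"
          by (rule continuous_on_subset[of "ball 0 1"]) (use p in \<open>auto simp: disc_Cb_def annulus_def\<close>)
        then show "path (p \<circ> circlepath 0 \<rho>)"
          by (intro path_continuous_image continuous_on_subset[OF _ img]) simp_all
        fix t
        have "norm (g r (circlepath 0 \<rho> t) - p (circlepath 0 \<rho> t)) \<le> supnorm r (\<lambda>z. g r z - p z)"
          using fam elim by (intro Cb_le_supnorm circ) (auto simp: family_def)
        also have "\<dots> < \<delta>" using elim by simp
        also have "\<delta> \<le> norm (p (circlepath 0 \<rho> t))"
          using circ[of t] elim by (intro low) (auto simp: annulus_def)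
        finally show "norm ((g r \<circ> circlepath 0 \<rho>) t - (p \<circ> circlepath 0 \<rho>) t) < norm ((p \<circ> circlepath 0 \<rho>) t - 0)"
          by simp
      qed (simp_all add: pathfinish_compose pathstart_compose)
      also have "\<dots> = 0" using \<rho> elim by (intro wind) auto
      finally show ?thesis .
    qed
    then have *: "\<forall>\<rho>\<in>{r<..<1}. winding_number (g r \<circ> circlepath 0 \<rho>) 0 = of_int 0" by simp
    \<comment> \<open>A radius exists in the interval, so the condition under \<open>THE\<close>
      pins down the integer.\<close>
    obtain \<rho> where \<rho>: "\<rho> \<in> {r<..<1}" using elim dense[of r 1] by auto
    show ?case
      unfolding annulus_winding_def
    proof (rule the_equality, rule *)
      fix n assume "\<forall>\<rho>\<in>{r<..<1}. winding_number (g r \<circ> circlepath 0 \<rho>) 0 = of_int n"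
      with * \<rho> have "of_int n = (of_int 0 :: complex)" by metis
      then show "n = 0" by simp
    qed
  qed
  then have "((\<lambda>r. annulus_winding r (g r)) \<longlongrightarrow> 0) (at_left 1)" by (rule tendsto_eventually)
  then show ?thesis
    unfolding index_def g_def by (intro tendsto_Lim) (auto simp: trivial_limit_at_left_real)
qed

text \<open>Two homotopies in the punctured plane: \<open>q\<close> moves straight to 1 inside the
  right half-plane, and then the circle shrinks to the centre while \<open>u\<close> stays nonzero.
  Continuity of \<open>u\<close> suffices, so \<open>u\<close> may contain conjugates of holomorphic
  functions.\<close>

lemma winding_number_circle_nonvanishing:
  assumes u: "continuous_on (ball 0 1) u" "\<And>z. norm z < 1 \<Longrightarrow> u z \<noteq> 0"
    and q: "continuous_on (ball 0 1) q" "\<And>z. norm z = r \<Longrightarrow> Re (q z) > 0"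
    and r: "0 < r" "r < 1"
  shows "winding_number ((\<lambda>z. u z * q z) \<circ> circlepath 0 r) 0 = 0"
proof -
  define \<gamma> where "\<gamma> = circlepath 0 r"
  have norm\<gamma>: "norm (\<gamma> t) = r" for t using r by (auto simp: \<gamma>_def circlepath norm_mult)
  then have img: "path_image \<gamma> \<subseteq> ball 0 1" using r by (auto simp: path_image_def)
  have \<gamma>: "path \<gamma>" "pathfinish \<gamma> = pathstart \<gamma>" by (simp_all add: \<gamma>_def)
  have pu: "path (u \<circ> \<gamma>)" by (intro path_continuous_image continuous_on_subset[OF u(1) img] \<gamma>)
  have "path ((\<lambda>z. u z * q z) \<circ> \<gamma>)"
    by (intro path_continuous_image continuous_on_subset[OF _ img] continuous_intros u q \<gamma>)
  then have "winding_number ((\<lambda>z. u z * q z) \<circ> \<gamma>) 0 = winding_number (u \<circ> \<gamma>) 0"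
  proof (rule winding_number_homotopic_loops[OF homotopic_loops_linear[OF _ pu]])
    fix t :: real
    show "closed_segment (((\<lambda>z. u z * q z) \<circ> \<gamma>) t) ((u \<circ> \<gamma>) t) \<subseteq> - {0}"
    proof
      fix x assume "x \<in> closed_segment (((\<lambda>z. u z * q z) \<circ> \<gamma>) t) ((u \<circ> \<gamma>) t)"
      \<comment> \<open>Each point of the segment is \<open>u\<close> times a convex combination of
        \<open>q\<close> and 1; the latter has positive real part.\<close>
      then obtain s where s: "0 \<le> s" "s \<le> 1" and x: "x = u (\<gamma> t) * (of_real (1 - s) * q (\<gamma> t) + of_real s)"
        by (auto simp: closed_segment_def scaleR_conv_of_real algebra_simps)
      have "Re (of_real (1 - s) * q (\<gamma> t) + of_real s) = (1 - s) * Re (q (\<gamma> t)) + s" by simp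
      also have "\<dots> > 0"
        using s q(2)[OF norm\<gamma>[of t]] by (cases "s = 1") (auto intro: add_pos_nonneg)
      finally have "of_real (1 - s) * q (\<gamma> t) + of_real s \<noteq> 0" by (metis less_irrefl zero_complex.sel(1))
      with u(2)[of "\<gamma> t"] norm\<gamma>[of t] r show "x \<in> - {0}" by (simp add: x)
    qed
  qed (use \<gamma> in \<open>simp_all add: pathfinish_compose pathstart_compose\<close>)
  also have "\<dots> = winding_number (u \<circ> (\<lambda>_. 0)) 0"
  proof (intro winding_number_homotopic_loops homotopic_loops_continuous_image[OF _ u(1)])
    show "homotopic_loops (ball 0 1) \<gamma> (\<lambda>_. 0)"
    proof (rule homotopic_loops_linear)
      show "closed_segment (\<gamma> t) 0 \<subseteq> ball 0 1" for t
        using norm\<gamma>[of t] r by (intro closed_segment_subset) auto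
      show "path (\<lambda>_. 0)" by (simp add: path_def)
      show "pathfinish (\<lambda>_. 0) = pathstart (\<lambda>_. 0)" by (simp add: pathfinish_def pathstart_def)
    qed (fact \<gamma>)+
    show "u \<in> ball 0 1 \<rightarrow> - {0}" using u(2) by auto
  qed
  also have "\<dots> = 0"
    using winding_number_zero_const[of "u 0" 0] u(2)[of 0] by (simp add: o_def)
  finally show ?thesis by (simp add: \<gamma>_def)
qed

section \<open>Independence of the coprime factorisation\<close>

lemma coprime_factorisation_unique:
  assumes "coprime_factorisation p n d" "coprime_factorisation p n' d'"
  obtains u where "u dvd 1" "n' = u * n" "d' = u * d"
proof -
  obtain x y where xy: "n * x + d * y = 1" "d \<noteq> 0" "p = Fract n d"
    using assms(1) by (auto simp: coprime_factorisation_def)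
  obtain x' y' where xy': "n' * x' + d' * y' = 1" "d' \<noteq> 0" "p = Fract n' d'"
    using assms(2) by (auto simp: coprime_factorisation_def)
  have nd: "n * d' = n' * d" using xy xy' by (simp add: eq_fract)
  \<comment> \<open>The first Bezout identity together with \<open>n * d' = n' * d\<close> shows
    that this is the common ratio of the two factorisations; the second Bezout identity makes it a
    unit.\<close>
  define u where "u = n' * x + d' * y"
  have "u * n = n' * (n * x + d * y)" "u * d = d' * (n * x + d * y)"
    using nd by (simp_all add: u_def algebra_simps)
  then have un: "n' = u * n" "d' = u * d" by (simp_all add: xy)
  then have "1 = u * (n * x' + d * y')" using xy'(1) by (simp add: algebra_simps)
  then have "u dvd 1" by (rule dvdI)
  with un that show ?thesis by blast
qed

lemma limalg_of_hinf_mult: "limalg_of_hinf (f * g) = limalg_of_hinf f * limalg_of_hinf g"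
  by (simp add: limalg_of_hinf_eq_class limalg_class_mult hinf_fun_disc_Cb times_hinf.rep_eq)

lemma limalg_of_hinf_1: "limalg_of_hinf 1 = 1"
  unfolding limalg_of_hinf_eq_class limalg_class_1[symmetric]
  by (rule limalg_class_eqI[of _ _ 0]) (simp_all add: hinf_fun_disc_Cb disc_Cb_const, simp add: one_hinf.rep_eq)

lemma limalg_of_hinf_unit: "u dvd 1 \<Longrightarrow> limalg_of_hinf u dvd 1"
  by (metis dvd_def limalg_of_hinf_1 limalg_of_hinf_mult)

text \<open>Characters send units to nonzero numbers, and the quotient is invariant under scaling
  either pair by such a number.\<close>

lemma chordal_fact_unit_mult:
  assumes "u1 dvd 1" "u2 dvd 1"
  shows "chordal_fact (u1 * n1) (u1 * d1) (u2 * n2) (u2 * d2) = chordal_fact n1 d1 n2 d2"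
  unfolding chordal_fact_def gelfand_def
proof (rule SUP_cong[OF refl])
  fix \<phi> assume \<phi>: "\<phi> \<in> max_ideal_space"
  show "chordal_quotient (\<phi> (limalg_of_hinf (u1 * n1))) (\<phi> (limalg_of_hinf (u1 * d1)))
      (\<phi> (limalg_of_hinf (u2 * n2))) (\<phi> (limalg_of_hinf (u2 * d2))) =
    chordal_quotient (\<phi> (limalg_of_hinf n1)) (\<phi> (limalg_of_hinf d1))
      (\<phi> (limalg_of_hinf n2)) (\<phi> (limalg_of_hinf d2))"
    unfolding limalg_of_hinf_mult max_ideal_spaceD(2)[OF \<phi>]
    by (intro chordal_quotient_scale max_ideal_spaceD(5)[OF \<phi>] limalg_of_hinf_unit assms)
qed

text \<open>The choice operator has only one candidate, because any other factorisations differ from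
  the given ones by units.\<close>

lemma chordal_dist_eqI:
  assumes "coprime_factorisation p1 n1 d1" "coprime_factorisation p2 n2 d2"
  shows "chordal_dist p1 p2 = chordal_fact n1 d1 n2 d2"
  unfolding chordal_dist_def
proof (rule some_equality)
  fix \<delta> assume "\<exists>n1 d1 n2 d2. coprime_factorisation p1 n1 d1 \<and> coprime_factorisation p2 n2 d2 \<and>
    \<delta> = chordal_fact n1 d1 n2 d2"
  then obtain n1' d1' n2' d2' where *: "coprime_factorisation p1 n1' d1'" "coprime_factorisation p2 n2' d2'"
    "\<delta> = chordal_fact n1' d1' n2' d2'" by blast
  from coprime_factorisation_unique[OF assms(1) *(1)]
  obtain u1 where u1: "u1 dvd 1" "n1' = u1 * n1" "d1' = u1 * d1" .
  from coprime_factorisation_unique[OF assms(2) *(2)]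
  obtain u2 where u2: "u2 dvd 1" "n2' = u2 * n2" "d2' = u2 * d2" .
  show "\<delta> = chordal_fact n1 d1 n2 d2"
    unfolding *(3) u1 u2 by (rule chordal_fact_unit_mult) (fact u1 u2)+
qed (use assms in blast)

lemma graph_pairing_eq_class:
  "graph_pairing n1 d1 n2 d2 =
    limalg_class (\<lambda>z. cnj (hinf_fun n1 z) * hinf_fun n2 z + cnj (hinf_fun d1 z) * hinf_fun d2 z)"
  unfolding graph_pairing_def limalg_of_hinf_eq_class
  by (simp add: limalg_class_cnj limalg_class_mult limalg_class_add hinf_fun_disc_Cb disc_Cb_cnj disc_Cb_mult)

text \<open>The pairing becomes \<open>u * q\<close> with \<open>u = cnj u1 * u2\<close>. Here
  \<open>u\<close> is bounded away from 0 on the whole disc and \<open>q\<close> has real part at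
  least \<open>\<delta>\<close> near the circle, so the product is invertible there and does not
  wind.\<close>

lemma graph_pairing_unit_mult:
  assumes "u1 dvd 1" "u2 dvd 1" "r0 < 1" "0 < \<delta>"
    and pos: "\<And>z. r0 < norm z \<Longrightarrow> norm z < 1 \<Longrightarrow>
      \<delta> \<le> Re (cnj (hinf_fun n1 z) * hinf_fun n2 z + cnj (hinf_fun d1 z) * hinf_fun d2 z)"
  shows "graph_pairing (u1 * n1) (u1 * d1) (u2 * n2) (u2 * d2) dvd 1"
    and "index (graph_pairing (u1 * n1) (u1 * d1) (u2 * n2) (u2 * d2)) = 0"
proof -
  define q where "q z = cnj (hinf_fun n1 z) * hinf_fun n2 z + cnj (hinf_fun d1 z) * hinf_fun d2 z" for z
  define u where "u z = cnj (hinf_fun u1 z) * hinf_fun u2 z" for z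
  have q: "q \<in> disc_Cb" and u: "u \<in> disc_Cb"
    unfolding q_def u_def by (intro disc_Cb_add disc_Cb_mult disc_Cb_cnj hinf_fun_disc_Cb)+
  have eq: "graph_pairing (u1 * n1) (u1 * d1) (u2 * n2) (u2 * d2) = limalg_class (\<lambda>z. u z * q z)"
    unfolding graph_pairing_eq_class times_hinf.rep_eq u_def q_def by (simp add: algebra_simps)
  \<comment> \<open>A bound \<open>C\<close> for the inverse of \<open>u1 * u2\<close> gives the
    lower bound \<open>1 / C\<close> for the modulus of \<open>u\<close>.\<close>
  obtain v where v: "1 = u1 * u2 * v"
    using assms(1,2) by (metis dvdE mult_dvd_mono mult_1)
  obtain C where C: "\<And>z. z \<in> ball 0 1 \<Longrightarrow> norm (hinf_fun v z) \<le> C" "0 < C"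
    using hinf_fun_bounded[of v] unfolding bounded_pos by blast
  have ulow: "1 / C \<le> norm (u z)" if "norm z < 1" for z
  proof -
    have "hinf_fun 1 z = hinf_fun (u1 * u2 * v) z" using v by simp
    then have "hinf_fun u1 z * hinf_fun u2 z * hinf_fun v z = 1"
      using that by (simp add: times_hinf.rep_eq one_hinf.rep_eq)
    then have "norm (u z) * norm (hinf_fun v z) = 1"
      by (metis complex_mod_cnj norm_mult norm_one u_def)
    moreover have "norm (u z) * norm (hinf_fun v z) \<le> norm (u z) * C"
      using C(1)[of z] that by (intro mult_left_mono) auto
    ultimately show ?thesis using C(2) by (simp add: field_simps)
  qed
  have low: "1 / C * \<delta> \<le> norm (u z * q z)" if "r0 < norm z" "norm z < 1" for z
    unfolding norm_mult
  proof (rule mult_mono)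
    show "\<delta> \<le> norm (q z)"
      using pos[OF that] complex_Re_le_cmod[of "q z"] unfolding q_def by linarith
  qed (use ulow[OF that(2)] \<open>0 < \<delta>\<close> in auto)
  have uq: "(\<lambda>z. u z * q z) \<in> disc_Cb" by (intro disc_Cb_mult u q)
  have "1 / C * \<delta> > 0" using C \<open>0 < \<delta>\<close> by simp
  note * = uq \<open>r0 < 1\<close> this low
  show "graph_pairing (u1 * n1) (u1 * d1) (u2 * n2) (u2 * d2) dvd 1"
    unfolding eq by (rule limalg_class_invertible[OF *])
  show "index (graph_pairing (u1 * n1) (u1 * d1) (u2 * n2) (u2 * d2)) = 0"
    unfolding eq
  proof (rule index_limalg_class_eq_0[OF *], assumption+, rule winding_number_circle_nonvanishing)
    fix z :: complex and r :: real assume "norm z = r" "r0 < r" "r < 1"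
    with pos[of z] \<open>0 < \<delta>\<close> show "Re (q z) > 0" by (simp add: q_def)
  next
    fix z :: complex assume "norm z < 1"
    with ulow[of z] C show "u z \<noteq> 0" by auto
  qed (use u q in \<open>auto simp: disc_Cb_def\<close>)
qed

text \<open>Positivity for one pair of factorisations puts \<open>nu_fact\<close> into its first
  branch for all of them, so every candidate of the choice operator is the same chordal
  value.\<close>

lemma nu_dist_eqI:
  assumes "coprime_factorisation p1 n1 d1" "coprime_factorisation p2 n2 d2" "r0 < 1" "0 < \<delta>"
    and pos: "\<And>z. r0 < norm z \<Longrightarrow> norm z < 1 \<Longrightarrow>
      \<delta> \<le> Re (cnj (hinf_fun n1 z) * hinf_fun n2 z + cnj (hinf_fun d1 z) * hinf_fun d2 z)"
  shows "nu_dist p1 p2 = chordal_fact n1 d1 n2 d2"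
  unfolding nu_dist_def
proof (rule some_equality)
  have *: "nu_fact (u1 * n1) (u1 * d1) (u2 * n2) (u2 * d2) = chordal_fact n1 d1 n2 d2"
    if "u1 dvd 1" "u2 dvd 1" for u1 u2
    unfolding nu_fact_def
    using graph_pairing_unit_mult[OF that assms(3-5)] chordal_fact_unit_mult[OF that] by simp
  from *[of 1 1] show "\<exists>n1' d1' n2' d2'. coprime_factorisation p1 n1' d1' \<and>
      coprime_factorisation p2 n2' d2' \<and> chordal_fact n1 d1 n2 d2 = nu_fact n1' d1' n2' d2'"
    using assms(1,2) by (intro exI[of _ n1] exI[of _ d1] exI[of _ n2] exI[of _ d2]) simp
  fix \<delta> assume "\<exists>n1 d1 n2 d2. coprime_factorisation p1 n1 d1 \<and> coprime_factorisation p2 n2 d2 \<and>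
    \<delta> = nu_fact n1 d1 n2 d2"
  then obtain n1' d1' n2' d2' where **: "coprime_factorisation p1 n1' d1'" "coprime_factorisation p2 n2' d2'"
    "\<delta> = nu_fact n1' d1' n2' d2'" by blast
  from coprime_factorisation_unique[OF assms(1) **(1)]
  obtain u1 where u1: "u1 dvd 1" "n1' = u1 * n1" "d1' = u1 * d1" .
  from coprime_factorisation_unique[OF assms(2) **(2)]
  obtain u2 where u2: "u2 dvd 1" "n2' = u2 * n2" "d2' = u2 * d2" .
  show "\<delta> = chordal_fact n1 d1 n2 d2"
    unfolding **(3) u1 u2 by (rule *) (fact u1 u2)+
qed

section \<open>Hyperbolic functions on the sector\<close>

text \<open>The image of the closed right half-plane under \<open>csqrt\<close>: argument at most
  \<pi>/4 in modulus, together with 0.\<close>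

definition sector :: "complex set" where
  "sector = {w. \<bar>Im w\<bar> \<le> Re w}"

text \<open>The entire function sinh w / w; it absorbs the removable singularities of
  \<open>n_fun\<close> and of the Bezout coefficients at 0.\<close>

definition sinhc :: "complex \<Rightarrow> complex" where
  "sinhc w = (if w = 0 then 1 else sinh w / w)"

lemma sinh_conv_sinhc: "sinh w = w * sinhc w"
  by (simp add: sinhc_def)

lemma sinhc_holomorphic: "sinhc holomorphic_on UNIV"
proof (rule no_isolated_singularity'[of "{0}"])
  have "((sinh :: complex \<Rightarrow> complex) has_field_derivative cosh 0) (at 0)"
    by (auto intro!: derivative_eq_intros)
  then have "((\<lambda>h::complex. sinh h / h) \<longlongrightarrow> 1) (at 0)"
    by (simp add: DERIV_def)
  then have "(sinhc \<longlongrightarrow> 1) (at 0)"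
    by (rule Lim_transform_eventually) (auto simp: sinhc_def eventually_at_filter)
  then show "(sinhc \<longlongrightarrow> sinhc z) (at z within UNIV)" if "z \<in> {0}" for z
    using that by (simp add: sinhc_def)
  have "(\<lambda>w::complex. sinh w / w) holomorphic_on UNIV - {0}"
    unfolding sinh_field_def by (intro holomorphic_intros) auto
  then show "sinhc holomorphic_on UNIV - {0}"
    by (rule holomorphic_transform) (auto simp: sinhc_def)
qed auto

lemma sinhc_holomorphic_compose [holomorphic_intros]:
  "f holomorphic_on S \<Longrightarrow> (\<lambda>z. sinhc (f z)) holomorphic_on S"
  using holomorphic_on_compose_gen[OF _ sinhc_holomorphic, of f S] by (simp add: o_def)

lemma continuous_on_sinhc [continuous_intros]:
  "continuous_on S f \<Longrightarrow> continuous_on S (\<lambda>z. sinhc (f z))"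
  using continuous_on_compose2[OF holomorphic_on_imp_continuous_on[OF sinhc_holomorphic]] by blast

lemma sector_scale: "w \<in> sector \<Longrightarrow> 0 \<le> t \<Longrightarrow> of_real t * w \<in> sector"
  by (auto simp: sector_def abs_mult mult_left_mono)

lemma sector_Re_pos: "w \<in> sector \<Longrightarrow> w \<noteq> 0 \<Longrightarrow> Re w > 0"
  by (auto simp: sector_def complex_eq_iff)

lemma sector_Re_nonneg: "w \<in> sector \<Longrightarrow> Re w \<ge> 0"
  by (auto simp: sector_def)

lemma sector_norm_le: "w \<in> sector \<Longrightarrow> norm w \<le> 2 * Re w"
  using cmod_le[of w] by (auto simp: sector_def)

lemma sector_plus_1:
  assumes "w \<in> sector" shows "w + 1 \<noteq> 0" "norm w \<le> norm (w + 1)"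
proof -
  have r: "Re w \<ge> 0" by (rule sector_Re_nonneg[OF assms])
  then show "norm w \<le> norm (w + 1)" by (simp add: cmod_def power2_eq_square algebra_simps)
  have "Re (w + 1) \<noteq> 0" using r by simp
  then show "w + 1 \<noteq> 0" by (metis zero_complex.sel(1))
qed

lemma le_sinh:
  assumes "0 \<le> t" shows "t \<le> sinh (t::real)"
proof -
  have "\<bar>t\<bar> \<le> \<bar>sinh t\<bar>" using real_le_abs_sinh[of t] by (simp add: sinh_field_def exp_minus)
  moreover have "0 \<le> sinh t" using assms by simp
  ultimately show ?thesis by simp
qed

lemma sinh_Re_le_norm_sinh: "Re w \<ge> 0 \<Longrightarrow> sinh (Re w) \<le> norm (sinh w)"
  and sinh_Re_le_norm_cosh: "Re w \<ge> 0 \<Longrightarrow> sinh (Re w) \<le> norm (cosh w)"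
  for w :: complex
  by (rule power2_le_imp_le, simp_all add: norm_sinh_squared norm_cosh_squared)+

text \<open>Off 0 the real part is positive, and \<open>sinh (Re w)\<close> bounds both moduli from
  below.\<close>

lemma sector_nonzero:
  assumes "w \<in> sector" shows "sinhc w \<noteq> 0" "cosh w \<noteq> 0"
proof -
  have "sinhc w \<noteq> 0 \<and> cosh w \<noteq> 0"
  proof (cases "w = 0")
    case False
    then have "Re w > 0" by (rule sector_Re_pos[OF assms])
    then have "sinh (Re w) > 0" by simp
    then have "norm (sinh w) > 0" "norm (cosh w) > 0"
      using sinh_Re_le_norm_sinh[of w] sinh_Re_le_norm_cosh[of w] \<open>Re w > 0\<close> by auto
    then show ?thesis using False by (auto simp: sinhc_def)
  qed (simp add: sinhc_def)
  then show "sinhc w \<noteq> 0" "cosh w \<noteq> 0" by auto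
qed

text \<open>The difference is \<open>- exp (- w) / cosh w\<close>, where the numerator has modulus
  at most 1 and the denominator at least \<open>sinh (Re w)\<close>, hence at least
  \<open>Re w\<close>.\<close>

lemma norm_tanh_minus_1_le:
  fixes w :: complex
  assumes "Re w > 0"
  shows "norm (sinh w / cosh w - 1) \<le> 1 / Re w"
proof -
  have s: "Re w \<le> sinh (Re w)" using assms by (intro le_sinh) simp
  then have c: "Re w \<le> norm (cosh w)" using sinh_Re_le_norm_cosh[of w] assms by simp
  then have "cosh w \<noteq> 0" using assms by auto
  then have "sinh w / cosh w - 1 = - exp (- w) / cosh w"
    by (simp add: diff_divide_distrib flip: cosh_minus_sinh)
  then have "norm (sinh w / cosh w - 1) = exp (- Re w) / norm (cosh w)"
    by (simp add: norm_divide)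
  also have "\<dots> \<le> 1 / Re w"
    using assms c by (intro frac_le) auto
  finally show ?thesis .
qed

lemma csqrt_in_sector:
  assumes "Re s \<ge> 0" shows "csqrt s \<in> sector"
proof -
  have "(Re (csqrt s))\<^sup>2 - (Im (csqrt s))\<^sup>2 \<ge> 0"
    using assms arg_cong[OF power2_csqrt, of Re s] unfolding Re_power2 by simp
  then show ?thesis
    using Re_csqrt[of s] abs_le_square_iff[of "Im (csqrt s)" "Re (csqrt s)"] by (simp add: sector_def)
qed

text \<open>The branch cut meets the closed half-plane only at 0, where continuity follows from the
  modulus of \<open>csqrt z\<close> being the root of that of \<open>z\<close>.\<close>

lemma continuous_on_csqrt_right_half_plane: "continuous_on {s. Re s \<ge> 0} csqrt"
proof (unfold continuous_on, intro ballI)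
  fix s assume "s \<in> {s. Re s \<ge> 0}"
  then have s: "Re s \<ge> 0" by simp
  show "(csqrt \<longlongrightarrow> csqrt s) (at s within {s. Re s \<ge> 0})"
  proof (cases "s = 0")
    case True
    have "((\<lambda>z. sqrt (norm z)) \<longlongrightarrow> sqrt (norm (0::complex))) (at 0 within {s. Re s \<ge> 0})"
      by (intro tendsto_intros)
    then have "((\<lambda>z. norm (csqrt z)) \<longlongrightarrow> 0) (at 0 within {s. Re s \<ge> 0})" by simp
    then show ?thesis unfolding True csqrt_0 by (rule tendsto_norm_zero_cancel)
  next
    case False
    with s have "s \<notin> \<real>\<^sub>\<le>\<^sub>0" by (auto simp: complex_nonpos_Reals_iff complex_eq_iff)
    then have "continuous (at s within {s. Re s \<ge> 0}) csqrt" by (rule continuous_within_csqrt)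
    then show ?thesis by (simp add: continuous_within)
  qed
qed

text \<open>The modulus is at most \<open>2 * Re w\<close> on the sector, so the part with
  \<open>Re w \<le> R\<close> is compact.\<close>

lemma bounded_image_sectorI:
  assumes cont: "continuous_on sector f" and B: "\<And>w. w \<in> sector \<Longrightarrow> R < Re w \<Longrightarrow> norm (f w) \<le> B"
  shows "bounded (f ` sector)"
proof -
  define K where "K = {w \<in> sector. Re w \<le> R}"
  have "closed K"
    unfolding K_def sector_def Collect_conj_eq mem_Collect_eq
    by (intro closed_Int closed_Collect_le continuous_intros)
  moreover have "norm w \<le> 2 * R" if "w \<in> K" for w
    using that sector_norm_le[of w] by (auto simp: K_def)
  then have "bounded K" by (auto simp: bounded_iff)
  ultimately have "compact K" by (simp add: compact_eq_bounded_closed)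
  then have "bounded (f ` K)"
    by (intro compact_imp_bounded compact_continuous_image continuous_on_subset[OF cont]) (auto simp: K_def)
  moreover have "bounded (f ` (sector - K))"
    unfolding bounded_iff using B by (intro exI[of _ B]) (force simp: K_def)
  moreover have "f ` sector = f ` K \<union> f ` (sector - K)" by (auto simp: K_def)
  ultimately show ?thesis by simp
qed

section \<open>The coprime factors in the variable \<open>csqrt s\<close>\<close>

text \<open>This form takes the correct value \<open>b\<close> at 0, whereas
  \<open>n_fun b 0\<close> is 0 through division by zero.\<close>

definition sector_n :: "real \<Rightarrow> complex \<Rightarrow> complex" where
  "sector_n b w = of_real b * sinhc (of_real b * w) / ((w + 1) * sinhc w)"

definition sector_d :: "real \<Rightarrow> complex \<Rightarrow> complex" where
  "sector_d b w = w / (w + 1) * (sinh (of_real b * w) / cosh (of_real b * w))"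

lemma n_fun_conv_sector_n: "s \<noteq> 0 \<Longrightarrow> n_fun b s = sector_n b (csqrt s)"
  by (simp add: n_fun_def sector_n_def sinh_conv_sinhc)

lemma d_fun_conv_sector_d: "d_fun b s = sector_d b (csqrt s)"
  by (simp add: d_fun_def sector_d_def)

lemma continuous_on_sector_n:
  "continuous_on ({0<..<1} \<times> sector) (\<lambda>(b, w). sector_n b w)"
  and continuous_on_sector_d:
  "continuous_on ({0<..<1} \<times> sector) (\<lambda>(b, w). sector_d b w)"
  unfolding sector_n_def sector_d_def case_prod_unfold
  using sector_plus_1(1) sector_nonzero sector_nonzero(2)[OF sector_scale]
  by (auto intro!: continuous_intros)

lemma norm_sector_n_le:
  assumes w: "w \<in> sector" "w \<noteq> 0" and b: "0 < b" "b < 1"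
  shows "norm (sector_n b w) \<le> sqrt 2 / norm w"
proof -
  have "Re w > 0" "\<bar>Im w\<bar> \<le> Re w" using sector_Re_pos[OF w] w by (auto simp: sector_def)
  note sb = sector_bounds[OF this b]
  have "norm (sector_n b w) = norm (sinh (of_real b * w)) / norm (sinh w) / norm (w + 1)"
    using w by (simp add: sector_n_def sinh_conv_sinhc norm_divide norm_mult divide_simps)
  also have "\<dots> \<le> sqrt 2 / norm w"
    using sb(1,3) sector_plus_1(2)[OF w(1)] w(2) by (intro frac_le) (auto simp: divide_simps)
  finally show ?thesis .
qed

text \<open>The rate at which \<open>d\<close> tends to 1 at infinity; its constant is continuous in
  \<open>b\<close>, which the joint continuity below requires.\<close>

lemma norm_sector_d_minus_1_le:
  assumes w: "w \<in> sector" "w \<noteq> 0" and b: "0 < b"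
  shows "norm (sector_d b w - 1) \<le> (2 / b + 1) / norm w"
proof -
  define T where "T = sinh (of_real b * w) / cosh (of_real b * w)"
  have nw: "norm w > 0" using w by simp
  have Re: "Re w > 0" by (rule sector_Re_pos[OF w])
  note w1 = sector_plus_1[OF w(1)]
  have "norm (T - 1) \<le> 1 / (b * Re w)"
    unfolding T_def using norm_tanh_minus_1_le[of "of_real b * w"] Re b by simp
  also have "\<dots> = 2 / (b * (2 * Re w))" by simp
  also have "\<dots> \<le> 2 / (b * norm w)"
    using sector_norm_le[OF w(1)] b nw Re by (intro divide_left_mono mult_left_mono mult_pos_pos) auto
  finally have T: "norm (T - 1) \<le> 2 / b / norm w" by simp
  have "w / (w + 1) + 1 / (w + 1) = 1" using w1(1) by (simp flip: add_divide_distrib)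
  moreover have "w / (w + 1) * (T - 1) - 1 / (w + 1) = w / (w + 1) * T - (w / (w + 1) + 1 / (w + 1))"
    by (simp add: right_diff_distrib)
  \<comment> \<open>Both errors are of order \<open>1 / norm w\<close>: the one of tanh, and the one
    of \<open>w / (w + 1)\<close>.\<close>
  ultimately have "sector_d b w - 1 = w / (w + 1) * (T - 1) - 1 / (w + 1)"
    by (simp only: sector_d_def T_def)
  then have "norm (sector_d b w - 1) \<le> norm (w / (w + 1)) * norm (T - 1) + norm (1 / (w + 1))"
    by (metis norm_mult norm_triangle_ineq4)
  also have "\<dots> \<le> 1 * (2 / b / norm w) + 1 / norm w"
    using w1 nw T by (intro add_mono mult_mono) (auto simp: norm_divide divide_simps)
  also have "\<dots> = (2 / b + 1) / norm w" by (simp add: add_divide_distrib)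
  finally show ?thesis .
qed

section \<open>Continuous extension to the closed disc\<close>

definition cayley_sqrt :: "complex \<Rightarrow> complex" where
  "cayley_sqrt z = csqrt ((1 + z) / (1 - z))"

text \<open>Division by zero makes \<open>cayley_sqrt 1 = 0\<close>, so the values at the point 1,
  the limits for w tending to infinity, are set by hand here and in \<open>disc_d\<close>.\<close>

definition disc_n :: "real \<Rightarrow> complex \<Rightarrow> complex" where
  "disc_n b z = (if z = 1 then 0 else sector_n b (cayley_sqrt z))"

definition disc_d :: "real \<Rightarrow> complex \<Rightarrow> complex" where
  "disc_d b z = (if z = 1 then 1 else sector_d b (cayley_sqrt z))"

lemma Re_cayley_nonneg:
  assumes "norm z \<le> 1" shows "Re ((1 + z) / (1 - z)) \<ge> 0"
proof -
  have "(norm z)\<^sup>2 \<le> 1" using assms by (simp add: abs_square_le_1)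
  then have "(Re z)\<^sup>2 + (Im z)\<^sup>2 \<le> 1" by (simp only: cmod_power2)
  then have "(1 + Re z) * (1 - Re z) - Im z * Im z \<ge> 0"
    by (simp add: power2_eq_square algebra_simps)
  then show ?thesis by (simp add: Re_divide algebra_simps)
qed

lemma cayley_sqrt_in_sector: "norm z \<le> 1 \<Longrightarrow> cayley_sqrt z \<in> sector"
  unfolding cayley_sqrt_def by (intro csqrt_in_sector Re_cayley_nonneg)

lemma norm_cayley_sqrt: "norm (cayley_sqrt z) = sqrt (norm (1 + z) / norm (1 - z))"
  by (simp add: cayley_sqrt_def norm_divide)

lemma continuous_on_cayley_sqrt: "continuous_on (cball 0 1 - {1}) cayley_sqrt"
  unfolding cayley_sqrt_def
  by (rule continuous_on_compose2[OF continuous_on_csqrt_right_half_plane])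
     (auto intro!: continuous_intros Re_cayley_nonneg)

text \<open>Away from 1 this is composition. At 1 the error is at most \<open>C b / norm w\<close>,
  where \<open>C\<close> stays bounded near the given parameter and \<open>w = cayley_sqrt z\<close>
  tends to infinity.\<close>

lemma continuous_on_extend_at_1:
  fixes f :: "real \<Rightarrow> complex \<Rightarrow> complex"
  assumes cont: "continuous_on ({0<..<1} \<times> sector) (\<lambda>(b, w). f b w)"
    and C: "continuous_on {0<..<1} C"
    and le: "\<And>b w. w \<in> sector \<Longrightarrow> w \<noteq> 0 \<Longrightarrow> 0 < b \<Longrightarrow> b < 1 \<Longrightarrow> norm (f b w - l) \<le> C b / norm w"
  shows "continuous_on ({0<..<1} \<times> cball 0 1) (\<lambda>(b, z). if z = 1 then l else f b (cayley_sqrt z))"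
    (is "continuous_on ?A ?g")
proof (unfold continuous_on, intro ballI)
  fix p assume "p \<in> ?A"
  then obtain a z0 where p: "p = (a, z0)" "0 < a" "a < 1" "norm z0 \<le> 1" by auto
  show "(?g \<longlongrightarrow> ?g p) (at p within ?A)"
  proof (cases "z0 = 1")
    case False
    let ?B = "{0<..<1} \<times> (cball 0 1 - {1})"
    have "continuous_on ?B (\<lambda>p. case (fst p, cayley_sqrt (snd p)) of (b, w) \<Rightarrow> f b w)"
      by (rule continuous_on_compose2[OF cont])
         (auto intro!: continuous_intros continuous_on_compose2[OF continuous_on_cayley_sqrt] cayley_sqrt_in_sector)
    then have "continuous_on ?B ?g"
      by (rule continuous_on_eq) (auto split: if_splits)
    moreover have "p \<in> ?B" using p False by auto
    ultimately have "(?g \<longlongrightarrow> ?g p) (at p within ?B)" unfolding continuous_on by blast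
    moreover have "at p within ?B = at p within ?A"
      by (rule at_within_nhd[of _ "UNIV \<times> (-{1})"]) (use p False in \<open>auto intro: open_Times\<close>)
    ultimately show ?thesis by simp
  next
    case True
    \<comment> \<open>The root is \<open>1 / norm (cayley_sqrt z)\<close>, by
      \<open>norm_cayley_sqrt\<close>.\<close>
    let ?h = "\<lambda>(b, z). C b * sqrt (norm (1 - z) / norm (1 + z))"
    have "(C \<longlongrightarrow> C a) (at a within {0<..<1})" using C p by (auto simp: continuous_on)
    then have "isCont C a" using p by (simp add: isCont_def at_within_open[of _ "{0<..<1}"])
    then have "((\<lambda>p. C (fst p)) \<longlongrightarrow> C (fst p)) (at p within ?A)"
      using p by (intro isCont_tendsto_compose[of "fst p" C] tendsto_intros) auto
    then have "(?h \<longlongrightarrow> C (fst p) * sqrt (norm (1 - snd p) / norm (1 + snd p))) (at p within ?A)"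
      unfolding case_prod_unfold using p True by (intro tendsto_intros) auto
    then have lim: "(?h \<longlongrightarrow> 0) (at p within ?A)" using p True by simp
    have "\<forall>\<^sub>F q in at p within ?A. snd q \<noteq> -1"
      using p True eventually_at_topological[of "\<lambda>q. snd q \<noteq> -1" p ?A]
      by (auto intro!: exI[of _ "UNIV \<times> (-{-1})"] open_Times)
    moreover have "\<forall>\<^sub>F q in at p within ?A. q \<in> ?A" by (simp add: eventually_at_filter)
    ultimately have "\<forall>\<^sub>F q in at p within ?A. norm (?g q - l) \<le> ?h q"
    proof eventually_elim
      case (elim q)
      obtain b z where q: "q = (b, z)" "0 < b" "b < 1" "norm z \<le> 1" "z \<noteq> -1" using elim by auto
      show ?case
      proof (cases "z = 1")
        case False
        \<comment> \<open>The point -1 corresponds to w = 0, where the estimate \<open>le\<close>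
          says nothing; near 1 it is avoided.\<close>
        with q(5) have "cayley_sqrt z \<noteq> 0"
          by (auto simp: cayley_sqrt_def add_eq_0_iff minus_equation_iff[of z 1])
        from le[OF cayley_sqrt_in_sector[OF q(4)] this q(2,3)] False show ?thesis
          by (simp add: q(1) norm_cayley_sqrt real_sqrt_divide)
      qed (simp add: q(1))
    qed
    from Lim_null_comparison[OF this lim] have "(?g \<longlongrightarrow> l) (at p within ?A)"
      by (simp add: LIM_zero_iff)
    then show ?thesis using p True by simp
  qed
qed

lemma continuous_on_disc_n: "continuous_on ({0<..<1} \<times> cball 0 1) (\<lambda>(b, z). disc_n b z)"
  unfolding disc_n_def
  by (rule continuous_on_extend_at_1[OF continuous_on_sector_n, where C = "\<lambda>_. sqrt 2"])
     (auto simp: norm_sector_n_le)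

lemma continuous_on_disc_d: "continuous_on ({0<..<1} \<times> cball 0 1) (\<lambda>(b, z). disc_d b z)"
  unfolding disc_d_def
  by (rule continuous_on_extend_at_1[OF continuous_on_sector_d, where C = "\<lambda>b. 2 / b + 1"])
     (auto simp: norm_sector_d_minus_1_le intro!: continuous_intros)

lemma continuous_on_section:
  assumes "continuous_on ({0<..<1} \<times> S) (\<lambda>(b, z). f b z)" "0 < b" "b < (1::real)"
  shows "continuous_on S (f b)"
proof -
  have "continuous_on S (\<lambda>z. case (b, z) of (b, z) \<Rightarrow> f b z)"
    by (rule continuous_on_compose2[OF assms(1)]) (use assms in \<open>auto intro!: continuous_intros\<close>)
  then show ?thesis by simp
qed

text \<open>\<open>disc_d\<close> vanishes only where w = 0, and there \<open>disc_n\<close> has the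
  value \<open>b\<close>.\<close>

lemma disc_n_disc_d_no_common_zero:
  assumes "0 < b" "norm z \<le> 1" "disc_d b z = 0" shows "disc_n b z \<noteq> 0"
proof -
  have z: "z \<noteq> 1" and d: "sector_d b (cayley_sqrt z) = 0"
    using assms(3) by (auto simp: disc_d_def split: if_splits)
  have w: "cayley_sqrt z \<in> sector" using assms(2) by (rule cayley_sqrt_in_sector)
  have bw: "of_real b * cayley_sqrt z \<in> sector" using w assms(1) by (intro sector_scale) auto
  have "cayley_sqrt z = 0"
    using d sector_plus_1(1)[OF w] sector_nonzero[OF bw] assms(1)
    by (auto simp: sector_d_def sinh_conv_sinhc)
  then show ?thesis using z assms(1) by (simp add: disc_n_def sector_n_def sinhc_def)
qed

lemma hinf_fun_to_disc_n_fun: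
  assumes "0 < b" "b < 1" "norm z < 1"
  shows "hinf_fun (to_disc (n_fun b)) z = disc_n b z"
proof -
  have "(1 + z) / (1 - z) \<noteq> 0" using Re_cayley_pos[of z] assms(3) by (metis less_irrefl mem_ball_0 zero_complex.sel(1))
  then show ?thesis
    using assms hinf_fun_to_disc[OF n_fun_d_fun_in_hinf_half_plane(1)[OF assms(1,2)]]
    by (auto simp: disc_n_def n_fun_conv_sector_n cayley_sqrt_def)
qed

lemma hinf_fun_to_disc_d_fun:
  assumes "0 < b" "b < 1" "norm z < 1"
  shows "hinf_fun (to_disc (d_fun b)) z = disc_d b z"
  using assms hinf_fun_to_disc[OF n_fun_d_fun_in_hinf_half_plane(2)[OF assms(1,2)]]
  by (auto simp: disc_d_def d_fun_conv_sector_d cayley_sqrt_def)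

section \<open>Boundary values\<close>

text \<open>The limit at y = 0 ignores the value of \<open>f\<close> at 0, so the continuous
  \<open>g\<close> supplies it.\<close>

lemma boundary_value_eqI:
  assumes cont: "continuous_on sector g" and eq: "\<And>s. Re s \<ge> 0 \<Longrightarrow> s \<noteq> 0 \<Longrightarrow> f s = g (csqrt s)"
  shows "boundary_value f y = g (csqrt (\<i> * of_real y))"
proof (cases "y = 0")
  case True
  have c: "continuous_on UNIV (\<lambda>t::real. csqrt (\<i> * of_real t))"
    by (rule continuous_on_compose2[OF continuous_on_csqrt_right_half_plane]) (auto intro!: continuous_intros)
  have "continuous_on UNIV (\<lambda>t::real. g (csqrt (\<i> * of_real t)))"
    by (rule continuous_on_compose2[OF cont c]) (auto intro!: csqrt_in_sector)
  then have "((\<lambda>t::real. g (csqrt (\<i> * of_real t))) \<longlongrightarrow> g (csqrt (\<i> * of_real 0))) (at 0)"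
    by (metis UNIV_I continuous_on)
  then have "((\<lambda>t::real. f (\<i> * of_real t)) \<longlongrightarrow> g (csqrt (\<i> * of_real 0))) (at 0)"
    by (rule Lim_transform_eventually) (auto simp: eventually_at_filter eq)
  then have "Lim (at 0) (\<lambda>t::real. f (\<i> * of_real t)) = g (csqrt (\<i> * of_real 0))"
    by (intro tendsto_Lim) auto
  with True show ?thesis by (simp add: boundary_value_def)
qed (simp add: boundary_value_def eq)

text \<open>The Cayley image of \<open>\<i> * y\<close>; it runs through the circle without the
  point 1.\<close>

definition circle_point :: "real \<Rightarrow> complex" where
  "circle_point y = (\<i> * of_real y - 1) / (\<i> * of_real y + 1)"

lemma circle_point:
  shows "circle_point y \<noteq> 1" "norm (circle_point y) = 1"
    "(1 + circle_point y) / (1 - circle_point y) = \<i> * of_real y"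
proof -
  have nz: "\<i> * of_real y + 1 \<noteq> 0" by (simp add: complex_eq_iff)
  then show "circle_point y \<noteq> 1" by (auto simp: circle_point_def divide_simps)
  have "norm (\<i> * of_real y - 1) = norm (\<i> * of_real y + 1)" by (simp add: cmod_def)
  with nz show "norm (circle_point y) = 1" by (simp add: circle_point_def norm_divide)
  have "1 + circle_point y = 2 * (\<i> * of_real y) / (\<i> * of_real y + 1)"
    "1 - circle_point y = 2 / (\<i> * of_real y + 1)"
    using nz by (simp_all add: circle_point_def field_simps)
  with nz show "(1 + circle_point y) / (1 - circle_point y) = \<i> * of_real y" by simp
qed

lemma circle_point_onto:
  assumes "norm z = 1" "z \<noteq> 1" obtains y where "z = circle_point y"
proof -
  define s where "s = (1 + z) / (1 - z)"
  have z: "(Re z)\<^sup>2 + (Im z)\<^sup>2 = 1" using assms(1) by (metis cmod_power2 one_power2)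
  have "(1 + Re z) * (1 - Re z) - Im z * Im z = 0"
    using z by (simp add: power2_eq_square algebra_simps)
  then have "Re s = 0" by (simp add: s_def Re_divide algebra_simps)
  then have s: "s = \<i> * of_real (Im s)" by (simp add: complex_eq_iff)
  have "s - 1 = 2 * z / (1 - z)" "s + 1 = 2 / (1 - z)"
    using assms(2) by (simp_all add: s_def field_simps)
  then have "z = (s - 1) / (s + 1)" using assms(2) by simp
  then have "z = circle_point (Im s)" unfolding circle_point_def using s by metis
  with that show ?thesis .
qed

lemma boundary_value_n_fun:
  assumes "0 < b" "b < 1" shows "boundary_value (n_fun b) y = disc_n b (circle_point y)"
  unfolding disc_n_def cayley_sqrt_def circle_point using circle_point(1)[of y]
    boundary_value_eqI[OF continuous_on_section[OF continuous_on_sector_n assms] n_fun_conv_sector_n]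
  by simp

lemma boundary_value_d_fun:
  assumes "0 < b" "b < 1" shows "boundary_value (d_fun b) y = disc_d b (circle_point y)"
  unfolding disc_d_def cayley_sqrt_def circle_point using circle_point(1)[of y]
    boundary_value_eqI[OF continuous_on_section[OF continuous_on_sector_d assms] d_fun_conv_sector_d]
  by simp

section \<open>Coprimeness\<close>

text \<open>With \<open>w = csqrt s\<close>, the Bezout identity is \<open>1 / cosh\<^sup>2 w + tanh\<^sup>2 w = 1\<close>, that is
  \<open>x = (w + 1) sinh w / (sinh (a w) cosh\<^sup>2 w)\<close> and \<open>y = (w + 1) tanh\<^sup>2 w / (w tanh (a w))\<close>.\<close>

definition bezout_x :: "real \<Rightarrow> complex \<Rightarrow> complex" where
  "bezout_x a w = (w + 1) * sinhc w / (of_real a * sinhc (of_real a * w) * (cosh w)\<^sup>2)"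

definition bezout_y :: "real \<Rightarrow> complex \<Rightarrow> complex" where
  "bezout_y a w = (w + 1) * (sinhc w)\<^sup>2 * cosh (of_real a * w) /
     (of_real a * sinhc (of_real a * w) * (cosh w)\<^sup>2)"

lemma bezout_identity:
  assumes "w \<in> sector" "0 < a"
  shows "sector_n a w * bezout_x a w + sector_d a w * bezout_y a w = 1"
proof -
  have aw: "of_real a * w \<in> sector" using assms by (intro sector_scale) auto
  note nz = sector_plus_1(1)[OF assms(1)] sector_nonzero[OF assms(1)] sector_nonzero[OF aw]
  have "sector_n a w * bezout_x a w = 1 / (cosh w)\<^sup>2"
    using nz assms(2) by (simp add: sector_n_def bezout_x_def)
  moreover have "sector_d a w * bezout_y a w = (sinh w)\<^sup>2 / (cosh w)\<^sup>2"
    using nz assms(2) by (simp add: sector_d_def bezout_y_def sinh_conv_sinhc power2_eq_square)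
  moreover have "1 + (sinh w)\<^sup>2 = (cosh w)\<^sup>2" by (simp add: cosh_square_eq)
  ultimately show ?thesis
    using nz by (simp flip: add_divide_distrib)
qed

text \<open>Far out, both coefficients are products of T = tanh w, the inverse of S = tanh (a w) and
  bounded factors, with T and S within 1/2 of 1. The rest of the sector is compact.\<close>

lemma bezout_bounded:
  assumes a: "0 < a" "a < 1"
  shows "bounded (bezout_x a ` sector)" "bounded (bezout_y a ` sector)"
proof -
  have nz: "\<And>w. w \<in> sector \<Longrightarrow> sinhc (of_real a * w) \<noteq> 0" "\<And>w. w \<in> sector \<Longrightarrow> cosh w \<noteq> 0"
    using a sector_nonzero sector_scale by simp_all
  have cont: "continuous_on sector (bezout_x a)" "continuous_on sector (bezout_y a)"
    unfolding bezout_x_def bezout_y_def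
    using nz a by (auto intro!: continuous_intros)
  have bound: "norm (bezout_x a w) \<le> 9 \<and> norm (bezout_y a w) \<le> 9"
    if w: "w \<in> sector" "2 / a < Re w" for w
  proof -
    define T where "T = sinh w / cosh w"
    define S where "S = sinh (of_real a * w) / cosh (of_real a * w)"
    \<comment> \<open>The threshold \<open>2 / a\<close> makes both \<open>Re w\<close> and
      \<open>a * Re w\<close> exceed 2, which serves T and S alike.\<close>
    have "2 \<le> 2 / a" using a by (simp add: field_simps)
    then have w2: "2 < Re w" using w(2) by linarith
    have aw: "2 < a * Re w" using w(2) a by (simp add: field_simps)
    have w0: "w \<noteq> 0" using w2 by auto
    have nw: "1 \<le> norm w" using complex_Re_le_cmod[of w] w2 by linarith
    have nz': "sinh (of_real a * w) \<noteq> 0" "cosh (of_real a * w) \<noteq> 0"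
      using nz(1)[OF w(1)] sector_nonzero(2)[OF sector_scale[OF w(1)]] a w0 by (auto simp: sinh_conv_sinhc)
    have "norm (T - 1) \<le> 1 / Re w" unfolding T_def using w2 by (intro norm_tanh_minus_1_le) auto
    also have "\<dots> \<le> 1 / 2" using w2 by (intro divide_left_mono) auto
    finally have T: "norm T \<le> 3 / 2" using norm_triangle_ineq2[of T 1] by simp
    have "norm (S - 1) \<le> 1 / (a * Re w)"
      unfolding S_def using norm_tanh_minus_1_le[of "of_real a * w"] aw by simp
    also have "\<dots> \<le> 1 / 2" using aw by (intro divide_left_mono) auto
    finally have S: "1 / 2 \<le> norm S" using norm_triangle_ineq2[of 1 S] by (simp add: norm_minus_commute)
    have cw: "Re w \<le> norm (cosh w)"
      using le_sinh[of "Re w"] sinh_Re_le_norm_cosh[of w] w2 by simp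
    have caw: "2 \<le> norm (cosh (of_real a * w))"
      using le_sinh[of "a * Re w"] sinh_Re_le_norm_cosh[of "of_real a * w"] aw by simp
    have w1: "norm (w + 1) \<le> norm w + 1" using norm_triangle_ineq[of w 1] by simp
    also have "\<dots> \<le> 3 * Re w" using sector_norm_le[OF w(1)] w2 by simp
    finally have w1c: "norm (w + 1) \<le> 3 * norm (cosh w)" using cw by simp
    have "bezout_x a w = (w + 1) / cosh w * T * (1 / S) * (1 / cosh (of_real a * w))"
      using w0 nz' nz[OF w(1)] a by (simp add: bezout_x_def T_def S_def sinhc_def power2_eq_square field_simps)
    then have "norm (bezout_x a w) = norm ((w + 1) / cosh w) * norm T * norm (1 / S) * norm (1 / cosh (of_real a * w))"
      by (simp only: norm_mult)
    also have "\<dots> \<le> 3 * (3 / 2) * 2 * 1"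
      using w1c nz(2)[OF w(1)] T S caw by (intro mult_mono) (auto simp: norm_divide divide_simps)
    finally have x: "norm (bezout_x a w) \<le> 9" by simp
    have "bezout_y a w = (w + 1) / w * T * T * (1 / S)"
      using w0 nz' nz[OF w(1)] a by (simp add: bezout_y_def T_def S_def sinhc_def power2_eq_square field_simps)
    then have "norm (bezout_y a w) = norm ((w + 1) / w) * norm T * norm T * norm (1 / S)"
      by (simp only: norm_mult)
    also have "\<dots> \<le> 2 * (3 / 2) * (3 / 2) * 2"
      using w1 nw T S by (intro mult_mono) (auto simp: norm_divide divide_simps)
    finally have y: "norm (bezout_y a w) \<le> 9" by simp
    with x show ?thesis by blast
  qed
  show "bounded (bezout_x a ` sector)" "bounded (bezout_y a ` sector)"
    using bound by (auto intro!: bounded_image_sectorI[OF cont(1)] bounded_image_sectorI[OF cont(2)])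
qed

lemma sector_function_in_hinf_half_plane:
  assumes "bounded (f ` sector)" "f holomorphic_on {w \<in> sector. Re w > 0}"
  shows "(\<lambda>s. f (csqrt s)) \<in> hinf_half_plane"
proof -
  have sec: "csqrt s \<in> {w \<in> sector. Re w > 0}" if "Re s > 0" for s
    using csqrt_sector[OF that] by (simp add: sector_def)
  have "csqrt holomorphic_on {s. Re s > 0}"
    by (intro holomorphic_on_csqrt') (auto simp: complex_nonpos_Reals_iff)
  then have "(\<lambda>s. f (csqrt s)) holomorphic_on {s. Re s > 0}"
    using holomorphic_on_compose_gen[OF _ assms(2), of csqrt "{s. Re s > 0}"] sec
    unfolding o_def by blast
  moreover have "bounded ((\<lambda>s. f (csqrt s)) ` {s. Re s > 0})"
    by (rule bounded_subset[OF assms(1)]) (use sec in auto)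
  ultimately show ?thesis by (simp add: hinf_half_plane_def)
qed

lemma coprime_factorisation_plant:
  assumes a: "0 < a" "a < 1"
  shows "coprime_factorisation (plant a) (to_disc (n_fun a)) (to_disc (d_fun a))"
  unfolding coprime_factorisation_def plant_def
proof (intro conjI refl exI)
  let ?x = "\<lambda>s. bezout_x a (csqrt s)" and ?y = "\<lambda>s. bezout_y a (csqrt s)"
  have nz: "\<And>w. w \<in> sector \<Longrightarrow> sinhc (of_real a * w) \<noteq> 0" "\<And>w. w \<in> sector \<Longrightarrow> cosh w \<noteq> 0"
    using a sector_nonzero sector_scale by simp_all
  have x: "?x \<in> hinf_half_plane" and y: "?y \<in> hinf_half_plane"
    unfolding bezout_x_def[abs_def] bezout_y_def[abs_def] using bezout_bounded[OF a] nz a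
    by (auto intro!: sector_function_in_hinf_half_plane holomorphic_intros
        simp: bezout_x_def[abs_def] bezout_y_def[abs_def] cosh_field_def)
  show "to_disc (n_fun a) * to_disc ?x + to_disc (d_fun a) * to_disc ?y = 1"
  proof (rule hinf_fun_inject[THEN iffD1], rule ext)
    fix z
    show "hinf_fun (to_disc (n_fun a) * to_disc ?x + to_disc (d_fun a) * to_disc ?y) z = hinf_fun 1 z"
    proof (cases "norm z < 1")
      case True
      then have "cayley_sqrt z \<in> sector" "z \<noteq> 1" by (auto intro: cayley_sqrt_in_sector)
      with True a bezout_identity[of "cayley_sqrt z" a] show ?thesis
        by (simp add: plus_hinf.rep_eq times_hinf.rep_eq one_hinf.rep_eq hinf_fun_to_disc_n_fun
            hinf_fun_to_disc_d_fun disc_n_def disc_d_def hinf_fun_to_disc[OF x] hinf_fun_to_disc[OF y]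
            flip: cayley_sqrt_def)
    next
      \<comment> \<open>Outside the disc both sides are 0 by the convention for
        \<open>hinf\<close>.\<close>
      case False
      then show ?thesis
        using hinf_fun[of "to_disc (n_fun a) * to_disc ?x + to_disc (d_fun a) * to_disc ?y"]
        by (simp add: one_hinf.rep_eq)
    qed
  qed
  \<comment> \<open>At the centre s = w = 1, and the value is tanh a / 2.\<close>
  have "disc_d a 0 \<noteq> 0"
    using sector_bounds(2)[of 1 a] sector_nonzero(1)[OF sector_scale, of 1 a] a
    by (simp add: disc_d_def sector_d_def cayley_sqrt_def sinh_conv_sinhc sector_def)
  then show "to_disc (d_fun a) \<noteq> 0"
    using hinf_fun_to_disc_d_fun[OF a, of 0] by (auto simp: zero_hinf.rep_eq)
qed

section \<open>Positivity of the pairing on the circle\<close>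

lemma pairing_pos_near:
  assumes a: "0 < a" "a < 1"
  obtains \<epsilon> where "0 < \<epsilon>"
    "\<And>b z. 0 < b \<Longrightarrow> b < 1 \<Longrightarrow> \<bar>b - a\<bar> < \<epsilon> \<Longrightarrow> norm z = 1 \<Longrightarrow>
      0 < Re (cnj (disc_n a z) * disc_n b z + cnj (disc_d a z) * disc_d b z)"
proof -
  define G where "G = (\<lambda>(b, z). Re (cnj (disc_n a z) * disc_n b z + cnj (disc_d a z) * disc_d b z))"
  \<comment> \<open>The closed interval of radius \<open>\<rho>\<close> about \<open>a\<close> stays
    inside (0,1), so that \<open>K\<close> is a compact part of the domain of joint
    continuity.\<close>
  define \<rho> where "\<rho> = min a (1 - a) / 2"
  define K where "K = cball a \<rho> \<times> sphere (0::complex) 1"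
  have \<rho>: "0 < \<rho>" "\<rho> < a" "\<rho> < 1 - a" using a by (auto simp: \<rho>_def)
  have K: "K \<subseteq> {0<..<1} \<times> cball 0 1" using \<rho> by (auto simp: K_def dist_real_def)
  have *: "continuous_on K (\<lambda>p. case (a, snd p) of (b, z) \<Rightarrow> f b z)" "continuous_on K (\<lambda>(b, z). f b z)"
    if "continuous_on ({0<..<1} \<times> cball 0 1) (\<lambda>(b, z). f b z)" for f :: "real \<Rightarrow> complex \<Rightarrow> complex"
  proof -
    show "continuous_on K (\<lambda>p. case (a, snd p) of (b, z) \<Rightarrow> f b z)"
      by (rule continuous_on_compose2[OF that]) (use a K in \<open>auto intro!: continuous_intros\<close>)
    show "continuous_on K (\<lambda>(b, z). f b z)" using that K by (rule continuous_on_subset)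
  qed
  have "continuous_on K G"
    unfolding G_def using *[OF continuous_on_disc_n] *[OF continuous_on_disc_d]
    by (auto intro!: continuous_intros simp: case_prod_unfold)
  moreover have "compact K" by (simp add: K_def compact_Times)
  ultimately have unif: "uniformly_continuous_on K G" by (rule compact_uniformly_continuous)
  have pos: "0 < G (a, z)" if "norm z = 1" for z
  proof -
    \<comment> \<open>For \<open>b = a\<close> the pairing is a sum of squared moduli without common
      zero.\<close>
    have "G (a, z) = (norm (disc_n a z))\<^sup>2 + (norm (disc_d a z))\<^sup>2"
      unfolding cmod_power2 by (simp add: G_def power2_eq_square)
    moreover have "disc_n a z \<noteq> 0 \<or> disc_d a z \<noteq> 0"
      using disc_n_disc_d_no_common_zero[of a z] a that by auto
    ultimately show ?thesis by (auto intro: add_pos_nonneg add_nonneg_pos)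
  qed
  have "continuous_on (sphere 0 1) (\<lambda>z. G (a, z))"
    by (rule continuous_on_compose2[OF \<open>continuous_on K G\<close>])
       (use \<rho> in \<open>auto intro!: continuous_intros simp: K_def\<close>)
  then obtain z0 where z0: "norm z0 = 1" "\<And>z. norm z = 1 \<Longrightarrow> G (a, z0) \<le> G (a, z)"
    using continuous_attains_inf[of "sphere (0::complex) 1" "\<lambda>z. G (a, z)"] by auto
  \<comment> \<open>The tolerance is the minimum of \<open>G\<close> over the circle at
    \<open>b = a\<close>; a smaller deviation cannot reach 0.\<close>
  obtain \<delta> where \<delta>: "0 < \<delta>" "\<And>p q. p \<in> K \<Longrightarrow> q \<in> K \<Longrightarrow> dist q p < \<delta> \<Longrightarrow> dist (G q) (G p) < G (a, z0)"
    using unif pos[OF z0(1)] unfolding uniformly_continuous_on_def by blast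
  have "0 < G (b, z)" if "\<bar>b - a\<bar> < min \<rho> \<delta>" "norm z = 1" for b z
  proof -
    have "dist (G (b, z)) (G (a, z)) < G (a, z0)"
      by (rule \<delta>(2)) (use that \<rho> in \<open>auto simp: K_def dist_Pair_Pair dist_real_def\<close>)
    with z0(2)[OF that(2)] show ?thesis by (simp add: dist_real_def)
  qed
  with \<rho> \<delta> show ?thesis by (intro that[of "min \<rho> \<delta>"]) (auto simp: G_def)
qed

section \<open>The chordal distance on the boundary\<close>

lemma chordal_quotient_nonneg: "0 \<le> chordal_quotient n1 d1 n2 d2"
  by (simp add: chordal_quotient_def)

text \<open>A crude bound that makes the suprema below well defined; Cauchy-Schwarz would give
  1.\<close>

lemma chordal_quotient_le_2: "chordal_quotient n1 d1 n2 d2 \<le> 2"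
proof -
  define r1 r2 where "r1 = sqrt ((norm n1)\<^sup>2 + (norm d1)\<^sup>2)" and "r2 = sqrt ((norm n2)\<^sup>2 + (norm d2)\<^sup>2)"
  have r: "norm n1 \<le> r1" "norm d1 \<le> r1" "norm n2 \<le> r2" "norm d2 \<le> r2"
    unfolding r1_def r2_def by (auto intro!: real_le_rsqrt)
  have "norm (n1 * d2 - n2 * d1) \<le> norm n1 * norm d2 + norm n2 * norm d1"
    by (metis norm_mult norm_triangle_ineq4)
  also have "\<dots> \<le> r1 * r2 + r2 * r1"
    using r by (intro add_mono mult_mono) (auto intro: order_trans[OF norm_ge_zero])
  finally have "norm (n1 * d2 - n2 * d1) \<le> 2 * (r1 * r2)" by simp
  moreover have "0 \<le> r1 * r2" by (simp add: r1_def r2_def)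
  ultimately show ?thesis
    unfolding chordal_quotient_def r1_def[symmetric] r2_def[symmetric]
    by (cases "r1 * r2 = 0") (auto simp: divide_le_eq)
qed

text \<open>Used to drop the points of the circle at which the quotient vanishes.\<close>

lemma cSup_insert_zero:
  fixes X :: "real set"
  assumes "X \<noteq> {}" "bdd_above X" "\<And>x. x \<in> X \<Longrightarrow> 0 \<le> x"
  shows "Sup (insert 0 X) = Sup X"
proof -
  obtain x where "x \<in> X" using assms(1) by blast
  then have "0 \<le> Sup X" using assms(2,3) by (metis cSup_upper order_trans)
  then show ?thesis by (simp add: cSup_insert[OF assms(1,2)] sup_real_def)
qed

lemma limalg_of_hinf_to_disc:
  assumes "0 < b" "b < 1"
  shows "limalg_of_hinf (to_disc (n_fun b)) = limalg_class (disc_n b)"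
    "limalg_of_hinf (to_disc (d_fun b)) = limalg_class (disc_d b)"
  unfolding limalg_of_hinf_eq_class
  using assms continuous_on_section[OF continuous_on_disc_n] continuous_on_section[OF continuous_on_disc_d]
  by (auto intro!: limalg_class_eqI[of _ _ 0] hinf_fun_disc_Cb continuous_cball_disc_Cb
      simp: hinf_fun_to_disc_n_fun hinf_fun_to_disc_d_fun)

abbreviation circle_quotient :: "real \<Rightarrow> real \<Rightarrow> complex \<Rightarrow> real" where
  "circle_quotient a b z \<equiv> chordal_quotient (disc_n a z) (disc_d a z) (disc_n b z) (disc_d b z)"

lemma chordal_fact_eq_SUP_circle:
  assumes a: "0 < a" "a < 1" and b: "0 < b" "b < 1"
  shows "chordal_fact (to_disc (n_fun a)) (to_disc (d_fun a)) (to_disc (n_fun b)) (to_disc (d_fun b)) =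
    (SUP z\<in>sphere 0 1. circle_quotient a b z)"
proof -
  note cont = continuous_on_section[OF continuous_on_disc_n] continuous_on_section[OF continuous_on_disc_d]
  let ?Q = "\<lambda>\<phi>. chordal_quotient (\<phi> (limalg_class (disc_n a))) (\<phi> (limalg_class (disc_d a)))
    (\<phi> (limalg_class (disc_n b))) (\<phi> (limalg_class (disc_d b)))"
  have "?Q ` max_ideal_space = circle_quotient a b ` sphere 0 1"
  proof (intro equalityI image_subsetI)
    fix \<phi> assume \<phi>: "\<phi> \<in> max_ideal_space"
    \<comment> \<open>All four functions are treated at once, because the quotient needs their
      values at one common point.\<close>
    have fin: "finite {disc_n a, disc_d a, disc_n b, disc_d b}" by simp
    have "\<forall>f\<in>{disc_n a, disc_d a, disc_n b, disc_d b}. continuous_on (cball 0 1) f"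
      by (simp add: cont a b)
    from max_ideal_space_boundary_point[OF \<phi> fin this]
    obtain z where z: "norm z = 1"
      and "\<forall>f\<in>{disc_n a, disc_d a, disc_n b, disc_d b}. \<phi> (limalg_class f) = f z" .
    then have "\<phi> (limalg_class (disc_n a)) = disc_n a z" "\<phi> (limalg_class (disc_d a)) = disc_d a z"
      "\<phi> (limalg_class (disc_n b)) = disc_n b z" "\<phi> (limalg_class (disc_d b)) = disc_d b z"
      by (simp_all only: ball_simps)
    then have "?Q \<phi> = circle_quotient a b z" by (simp only:)
    with z show "?Q \<phi> \<in> circle_quotient a b ` sphere 0 1" by (simp only: mem_sphere_0 image_eqI)
  next
    fix z :: complex assume "z \<in> sphere 0 1"
    then have "norm z = 1" by simp
    then obtain \<phi> where \<phi>: "\<phi> \<in> max_ideal_space"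
      "\<And>f. continuous_on (cball 0 1) f \<Longrightarrow> \<phi> (limalg_class f) = f z"
      by (rule boundary_point_character) blast
    have "?Q \<phi> = circle_quotient a b z"
      unfolding \<phi>(2)[OF cont(1)[OF a]] \<phi>(2)[OF cont(2)[OF a]]
        \<phi>(2)[OF cont(1)[OF b]] \<phi>(2)[OF cont(2)[OF b]] by (rule refl)
    then show "circle_quotient a b z \<in> ?Q ` max_ideal_space"
      by (rule image_eqI[where f = ?Q, OF sym \<phi>(1)])
  qed
  then show ?thesis
    unfolding chordal_fact_def gelfand_def limalg_of_hinf_to_disc[OF a] limalg_of_hinf_to_disc[OF b] by simp
qed

section \<open>From the circle to the positive half-line\<close>

lemma SUP_circle_eq_SUP_real:
  "(SUP z\<in>sphere 0 1. circle_quotient a b z) = (SUP y. circle_quotient a b (circle_point y))"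
proof -
  have "sphere 0 1 \<subseteq> insert 1 (range circle_point)"
  proof
    fix z :: complex assume "z \<in> sphere 0 1"
    then have "norm z = 1" by simp
    then show "z \<in> insert 1 (range circle_point)" by (cases "z = 1") (auto elim: circle_point_onto)
  qed
  moreover have "insert 1 (range circle_point) \<subseteq> sphere 0 1" using circle_point(2) by auto
  ultimately have "sphere 0 1 = insert 1 (range circle_point)" by (rule equalityI)
  \<comment> \<open>At infinity both numerators \<open>disc_n\<close> vanish.\<close>
  moreover have "circle_quotient a b 1 = 0"
    by (simp add: chordal_quotient_def disc_n_def)
  ultimately have "circle_quotient a b ` sphere 0 1 = insert 0 ((\<lambda>y. circle_quotient a b (circle_point y)) ` UNIV)"
    by (simp only: image_insert image_image)
  then show ?thesis
    by (simp only:) (intro cSup_insert_zero; auto intro!: bdd_aboveI[of _ 2] chordal_quotient_le_2 chordal_quotient_nonneg)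
qed

lemma circle_quotient_circle_point:
  assumes "y \<noteq> 0"
  shows "circle_quotient a b (circle_point y) = chordal_quotient (n_fun a (\<i> * of_real y)) (d_fun a (\<i> * of_real y))
    (n_fun b (\<i> * of_real y)) (d_fun b (\<i> * of_real y))"
  using assms circle_point
  by (simp add: disc_n_def disc_d_def cayley_sqrt_def n_fun_conv_sector_n d_fun_conv_sector_d)

lemma n_fun_cnj: "s \<notin> \<real>\<^sub>\<le>\<^sub>0 \<Longrightarrow> n_fun b (cnj s) = cnj (n_fun b s)"
  and d_fun_cnj: "s \<notin> \<real>\<^sub>\<le>\<^sub>0 \<Longrightarrow> d_fun b (cnj s) = cnj (d_fun b s)"
  by (simp_all add: n_fun_def d_fun_def cnj_csqrt[symmetric] sinh_field_def cosh_field_def exp_cnj)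

lemma chordal_quotient_cnj:
  "chordal_quotient (cnj n1) (cnj d1) (cnj n2) (cnj d2) = chordal_quotient n1 d1 n2 d2"
  by (simp add: chordal_quotient_def flip: complex_cnj_mult complex_cnj_diff)

text \<open>Negating y conjugates s, hence all four values, and the quotient depends only on
  moduli.\<close>

lemma circle_quotient_even: "circle_quotient a b (circle_point (- y)) = circle_quotient a b (circle_point y)"
proof (cases "y = 0")
  case False
  have s: "\<i> * of_real y \<notin> \<real>\<^sub>\<le>\<^sub>0" "\<i> * of_real (- y) = cnj (\<i> * of_real y)"
    using False by (auto simp: complex_nonpos_Reals_iff)
  have "- y \<noteq> 0" using False by simp
  show ?thesis
    unfolding circle_quotient_circle_point[OF False] circle_quotient_circle_point[OF \<open>- y \<noteq> 0\<close>]
    unfolding s(2) n_fun_cnj[OF s(1)] d_fun_cnj[OF s(1)] by (rule chordal_quotient_cnj)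
qed simp

lemma SUP_real_eq_SUP_pos:
  "(SUP y. circle_quotient a b (circle_point y)) = (SUP y\<in>{0<..}. circle_quotient a b (circle_point y))"
proof -
  let ?q = "\<lambda>y. circle_quotient a b (circle_point y)"
  \<comment> \<open>At s = 0 both denominators \<open>disc_d\<close> vanish.\<close>
  have "?q 0 = 0"
    by (simp add: chordal_quotient_def disc_d_def sector_d_def cayley_sqrt_def circle_point)
  have "?q y \<in> insert 0 (?q ` {0<..})" for y
  proof (rule linorder_cases[of y 0])
    assume "y < 0"
    then have "- y \<in> {0<..}" by simp
    from imageI[OF this, of ?q] show ?thesis by (simp only: circle_quotient_even insert_iff simp_thms)
  next
    assume "y = 0"
    with \<open>?q 0 = 0\<close> show ?thesis by (simp only: insert_iff simp_thms)
  next
    assume "y > 0"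
    then have "y \<in> {0<..}" by simp
    from imageI[OF this, of ?q] show ?thesis by (rule insertI2)
  qed
  then have "range ?q \<subseteq> insert 0 (?q ` {0<..})" by (rule image_subsetI)
  moreover have "0 \<in> range ?q" using \<open>?q 0 = 0\<close> by (rule range_eqI[OF sym])
  then have "insert 0 (?q ` {0<..}) \<subseteq> range ?q" by (simp only: insert_subset image_mono subset_UNIV simp_thms)
  ultimately have "range ?q = insert 0 (?q ` {0<..})" by (rule equalityI)
  then show ?thesis
    by (simp only:) (intro cSup_insert_zero; auto intro!: bdd_aboveI[of _ 2] chordal_quotient_le_2 chordal_quotient_nonneg)
qed

section \<open>Closed form on the positive imaginary axis\<close>

lemma csqrt_imaginary:
  assumes "0 < y"
  shows "csqrt (\<i> * of_real y) = of_real (sqrt y) * exp (\<i> * of_real pi / 4)"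
proof (rule csqrt_unique)
  have e: "exp (\<i> * of_real pi / 4) = cis (pi / 4)" by (simp add: cis_conv_exp)
  have "(cis (pi / 4))\<^sup>2 = \<i>" by (simp add: power2_eq_square cis_mult)
  moreover have "(complex_of_real (sqrt y))\<^sup>2 = of_real y"
    using assms by (simp only: of_real_power[symmetric]) simp
  ultimately show "(of_real (sqrt y) * exp (\<i> * of_real pi / 4))\<^sup>2 = \<i> * of_real y"
    by (simp add: e power_mult_distrib)
  \<comment> \<open>The positive real part singles out the principal root.\<close>
  show "0 < Re (of_real (sqrt y) * exp (\<i> * of_real pi / 4)) \<or>
      Re (of_real (sqrt y) * exp (\<i> * of_real pi / 4)) = 0 \<and> 0 \<le> Im (of_real (sqrt y) * exp (\<i> * of_real pi / 4))"
    using assms by (simp add: e cos_45)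
qed

lemma circle_quotient_closed_form:
  assumes "0 < a" "a < 1" "0 < b" "b < 1" "0 < y"
  defines "\<zeta> \<equiv> exp (\<i> * of_real pi / 4)"
  shows "circle_quotient a b (circle_point y) = sqrt y * norm (sinh (of_real (sqrt y) * \<zeta>)) *
               norm (cosh (of_real (a * sqrt y) * \<zeta>) - cosh (of_real (b * sqrt y) * \<zeta>)) /
             (sqrt ((norm (cosh (of_real (a * sqrt y) * \<zeta>)))\<^sup>2 +
                    y * (norm (sinh (of_real (sqrt y) * \<zeta>)))\<^sup>2) *
              sqrt ((norm (cosh (of_real (b * sqrt y) * \<zeta>)))\<^sup>2 +
                    y * (norm (sinh (of_real (sqrt y) * \<zeta>)))\<^sup>2))"
proof -
  have w: "csqrt (\<i> * of_real y) = of_real (sqrt y) * \<zeta>"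
    unfolding \<zeta>_def by (rule csqrt_imaginary[OF assms(5)])
  have "norm \<zeta> = 1" by (simp add: \<zeta>_def)
  then have nw: "norm (of_real (sqrt y) * \<zeta>) = sqrt y" "norm (\<i> * of_real y) = y"
    using assms(5) by (simp_all add: norm_mult)
  have s: "Re (\<i> * of_real y) \<ge> 0" "\<i> * of_real y \<noteq> 0" "y \<noteq> 0" using assms(5) by auto
  show ?thesis
    unfolding circle_quotient_circle_point[OF s(3)] chordal_quotient_n_fun_d_fun[OF s(1,2) assms(1-4)] w nw
    by (simp only: of_real_mult mult.assoc)
qed

section \<open>Assembling the statement\<close>

lemma n_fun_div_d_fun:
  assumes "0 < b" "b < 1" "Re s > 0"
  shows "d_fun b s \<noteq> 0" "n_fun b s / d_fun b s = p_fun b s"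
proof -
  define w where "w = csqrt s"
  have w: "w \<in> sector" "w \<noteq> 0" using assms(3) by (auto simp: w_def intro!: csqrt_in_sector)
  have bw: "of_real b * w \<in> sector" using w assms(1) by (intro sector_scale) auto
  have nz: "sinh w \<noteq> 0" "sinh (of_real b * w) \<noteq> 0" "cosh (of_real b * w) \<noteq> 0" "w + 1 \<noteq> 0"
    using sector_nonzero[OF w(1)] sector_nonzero[OF bw] sector_plus_1(1)[OF w(1)] w(2) assms(1)
    by (auto simp: sinh_conv_sinhc)
  with w show "d_fun b s \<noteq> 0" "n_fun b s / d_fun b s = p_fun b s"
    by (simp_all add: n_fun_def d_fun_def p_fun_def flip: w_def)
qed

lemma pairing_bounded_below_near_circle:
  assumes a: "0 < a" "a < 1" and b: "0 < b" "b < 1"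
    and pos: "\<And>z. norm z = 1 \<Longrightarrow> 0 < Re (cnj (disc_n a z) * disc_n b z + cnj (disc_d a z) * disc_d b z)"
  obtains r0 \<delta> where "r0 < 1" "0 < \<delta>"
    "\<And>z. r0 < norm z \<Longrightarrow> norm z < 1 \<Longrightarrow>
      \<delta> \<le> Re (cnj (hinf_fun (to_disc (n_fun a)) z) * hinf_fun (to_disc (n_fun b)) z +
              cnj (hinf_fun (to_disc (d_fun a)) z) * hinf_fun (to_disc (d_fun b)) z)"
proof -
  define q where "q z = Re (cnj (disc_n a z) * disc_n b z + cnj (disc_d a z) * disc_d b z)" for z
  note cont = continuous_on_section[OF continuous_on_disc_n] continuous_on_section[OF continuous_on_disc_d]
  \<comment> \<open>The compactness lemma bounds a norm, which does not see the sign of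
    \<open>q\<close>. For the positive part, a positive lower bound forces \<open>q\<close> itself
    to be at least \<open>\<delta>\<close>.\<close>
  have qc: "continuous_on (cball 0 1) (\<lambda>z. max 0 (q z))"
    unfolding q_def by (intro continuous_intros cont a b)
  have "\<forall>z\<in>sphere 0 1. max 0 (q z) \<noteq> 0"
  proof
    fix z :: complex assume "z \<in> sphere 0 1"
    then have "0 < q z" unfolding q_def by (intro pos) simp
    then show "max 0 (q z) \<noteq> 0" by simp
  qed
  from nonzero_on_circle_imp_bounded_below[OF qc this]
  obtain r0 \<delta> where r0: "0 < r0" "r0 < 1" "0 < \<delta>"
    "\<And>z. r0 < norm z \<Longrightarrow> norm z \<le> 1 \<Longrightarrow> \<delta> \<le> norm (max 0 (q z))"
    by blast
  have "\<delta> \<le> q z" if "r0 < norm z" "norm z < 1" for z using r0(3) r0(4)[of z] that by (auto simp: max_def split: if_splits)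
  with r0(2,3) show ?thesis
    by (intro that[of r0 \<delta>]) (simp_all add: q_def a b hinf_fun_to_disc_n_fun hinf_fun_to_disc_d_fun)
qed

theorem mainTheorem1:
  fixes a :: real
  assumes "0 < a" and "a < 1"
  shows "\<exists>\<epsilon>>0. \<forall>a'::real. 0 < a' \<and> a' < 1 \<and> \<bar>a' - a\<bar> < \<epsilon> \<longrightarrow>
    (let n = boundary_value (n_fun a); d = boundary_value (d_fun a);
         n' = boundary_value (n_fun a'); d' = boundary_value (d_fun a');
         P = graph_pairing (to_disc (n_fun a)) (to_disc (d_fun a))
               (to_disc (n_fun a')) (to_disc (d_fun a'));
         \<zeta> = exp (\<i> * of_real pi / 4)
     in (\<forall>y. Re (cnj (n y) * n' y + cnj (d y) * d' y) > 0) \<and>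
        P dvd 1 \<and> index P = 0 \<and>
        (\<forall>b\<in>{a, a'}. \<forall>s. Re s > 0 \<longrightarrow> d_fun b s \<noteq> 0 \<and> n_fun b s / d_fun b s = p_fun b s) \<and>
        nu_dist (plant a) (plant a') = chordal_dist (plant a) (plant a') \<and>
        nu_dist (plant a) (plant a') =
          (SUP y. norm (n y * d' y - d y * n' y) /
             (sqrt ((norm (n y))\<^sup>2 + (norm (d y))\<^sup>2) * sqrt ((norm (n' y))\<^sup>2 + (norm (d' y))\<^sup>2))) \<and>
        nu_dist (plant a) (plant a') =
          (SUP y\<in>{0<..}. sqrt y * norm (sinh (of_real (sqrt y) * \<zeta>)) *
               norm (cosh (of_real (a * sqrt y) * \<zeta>) - cosh (of_real (a' * sqrt y) * \<zeta>)) /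
             (sqrt ((norm (cosh (of_real (a * sqrt y) * \<zeta>)))\<^sup>2 +
                    y * (norm (sinh (of_real (sqrt y) * \<zeta>)))\<^sup>2) *
              sqrt ((norm (cosh (of_real (a' * sqrt y) * \<zeta>)))\<^sup>2 +
                    y * (norm (sinh (of_real (sqrt y) * \<zeta>)))\<^sup>2))))"
proof -
  obtain \<epsilon> where \<epsilon>: "0 < \<epsilon>" "\<And>b z. 0 < b \<Longrightarrow> b < 1 \<Longrightarrow> \<bar>b - a\<bar> < \<epsilon> \<Longrightarrow> norm z = 1 \<Longrightarrow>
      0 < Re (cnj (disc_n a z) * disc_n b z + cnj (disc_d a z) * disc_d b z)"
    using pairing_pos_near[OF assms] by blast
  show ?thesis
  proof (rule exI[of _ \<epsilon>], intro conjI allI impI \<epsilon>(1), unfold Let_def, goal_cases)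
    case (1 b)
    then have b: "0 < b" "b < 1" "\<bar>b - a\<bar> < \<epsilon>" by auto
    note bv = boundary_value_n_fun[OF assms] boundary_value_d_fun[OF assms]
      boundary_value_n_fun[OF b(1,2)] boundary_value_d_fun[OF b(1,2)]
    note cop = coprime_factorisation_plant[OF assms] coprime_factorisation_plant[OF b(1,2)]
    note pos = \<epsilon>(2)[OF b]
    obtain r0 \<delta> where r0: "r0 < 1" "0 < \<delta>" "\<And>z. r0 < norm z \<Longrightarrow> norm z < 1 \<Longrightarrow>
      \<delta> \<le> Re (cnj (hinf_fun (to_disc (n_fun a)) z) * hinf_fun (to_disc (n_fun b)) z +
              cnj (hinf_fun (to_disc (d_fun a)) z) * hinf_fun (to_disc (d_fun b)) z)"
      using pairing_bounded_below_near_circle[OF assms b(1,2) pos] by blast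
    let ?F = "chordal_fact (to_disc (n_fun a)) (to_disc (d_fun a)) (to_disc (n_fun b)) (to_disc (d_fun b))"
    have nu: "nu_dist (plant a) (plant b) = ?F" by (rule nu_dist_eqI[OF cop r0])
    have real: "?F = (SUP y. circle_quotient a b (circle_point y))"
      using chordal_fact_eq_SUP_circle[OF assms b(1,2)] SUP_circle_eq_SUP_real by simp
    show ?case
    proof (intro conjI allI ballI impI, goal_cases)
      case (1 y)
      show ?case unfolding bv by (rule pos[OF circle_point(2)])
    next
      case 2
      \<comment> \<open>The case in which both units are 1.\<close>
      show ?case using graph_pairing_unit_mult(1)[OF dvd_refl dvd_refl r0] by simp
    next
      case 3
      show ?case using graph_pairing_unit_mult(2)[OF dvd_refl dvd_refl r0] by simp
    next
      case (4 c s)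
      then have "0 < c" "c < 1" using assms b by auto
      then show ?case using 4(2) by (rule n_fun_div_d_fun)
    next
      case (5 c s)
      then have "0 < c" "c < 1" using assms b by auto
      then show ?case using 5(2) by (rule n_fun_div_d_fun)
    next
      case 6
      show ?case unfolding nu by (rule chordal_dist_eqI[OF cop, symmetric])
    next
      case 7
      show ?case unfolding nu real bv chordal_quotient_def by (simp add: mult.commute)
    next
      case 8
      show ?case unfolding nu real SUP_real_eq_SUP_pos
        by (rule SUP_cong[OF refl]) (simp only: circle_quotient_closed_form[OF assms b(1,2)] greaterThan_iff)
    qed
  qed
qed

end
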